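(* For every two connected bipartite graphs $G$ and $H$ such that at least one of them does not admit a VC$1$-EW, we have $\mu(G\Box H)=2$. Particularly, for even cycles $C_n$ and $C_m$, $\mu(C_n\Box C_m)=2$ and $\mu(C_n\Box P_m)=2$. Also $\mu(P_n\Box P_m)=2$, and for the cube graph $Q_n=K_2\Box K_2\Box\cdots\Box K_2$ ($n$ factors) we have $\mu(Q_n)=2$.
   Context: All graphs are finite and simple, and vertex-coloring edge-weightings are considered for connected graphs with at least three vertices. $P_n$ and $C_n$, $n\geq 3$, denote the path and the cycle with $n$ vertices, and $K_2$ is the complete graph on two vertices. A $k$-edge-weighting of a graph $G$ is a function $w:E(G)\to\{1,2,\ldots,k\}$. It induces a vertex coloring $c$ by $c(v)=\sum_{e\sim v}w(e)$, where $e\sim v$ means that $e$ is an edge incident to $v$. If $c$ is a proper vertex coloring ($c(u)\neq c(v)$ for every two adjacent vertices $u,v$), then $w$ is called a vertex-coloring $k$-edge-weighting (VC$k$-EW). $\mu(G)$ denotes the minimum $k$ for which $G$ has a VC$k$-EW. The Cartesian product $G\Box H$ has vertex set $V(G)\times V(H)$, with $(u,v)$ adjacent to $(u',v')$ if and only if $u=u'$ and $vv'\in E(H)$, or $v=v'$ and $uu'\in E(G)$.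
   Formalization: The case n = m = 3 of P_n □ P_m is excluded, since adjacent vertices of P_3 □ P_3 have different degrees and μ = 1; G and H have at least two vertices (K_1 □ C_6 = C_6 has μ = 3), and Q_n is taken with n ≥ 2, as Q_1 = K_2 has no VCk-EW. *)

theory Defs
  imports Main "HOL-Library.Extended_Nat"
begin

text \<open>An edge is the two-element set of its end vertices.\<close>

record 'a sgraph =
  vertices :: "'a set"
  edges :: "'a set set"

definition simple_graph :: "'a sgraph \<Rightarrow> bool" where
  "simple_graph G \<longleftrightarrow>
     finite (vertices G) \<and> (\<forall>e\<in>edges G. e \<subseteq> vertices G \<and> card e = 2)"

definition adjacent :: "'a sgraph \<Rightarrow> 'a \<Rightarrow> 'a \<Rightarrow> bool" where
  "adjacent G u v \<longleftrightarrow> {u, v} \<in> edges G"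

definition connected_graph :: "'a sgraph \<Rightarrow> bool" where
  "connected_graph G \<longleftrightarrow>
     vertices G \<noteq> {} \<and> (\<forall>u\<in>vertices G. \<forall>v\<in>vertices G. (adjacent G)\<^sup>*\<^sup>* u v)"

definition bipartite_graph :: "'a sgraph \<Rightarrow> bool" where
  "bipartite_graph G \<longleftrightarrow>
     (\<exists>X Y. X \<inter> Y = {} \<and> X \<union> Y = vertices G \<and>
        (\<forall>e\<in>edges G. \<exists>x\<in>X. \<exists>y\<in>Y. e = {x, y}))"

definition edge_weighting :: "'a sgraph \<Rightarrow> nat \<Rightarrow> ('a set \<Rightarrow> nat) \<Rightarrow> bool" where
  "edge_weighting G k w \<longleftrightarrow> (\<forall>e\<in>edges G. w e \<in> {1..k})"

definition induced_coloring :: "'a sgraph \<Rightarrow> ('a set \<Rightarrow> nat) \<Rightarrow> 'a \<Rightarrow> nat" where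
  "induced_coloring G w v = (\<Sum>e | e \<in> edges G \<and> v \<in> e. w e)"

definition proper_coloring :: "'a sgraph \<Rightarrow> ('a \<Rightarrow> nat) \<Rightarrow> bool" where
  "proper_coloring G c \<longleftrightarrow> (\<forall>u v. adjacent G u v \<longrightarrow> c u \<noteq> c v)"

definition VCEW :: "'a sgraph \<Rightarrow> nat \<Rightarrow> ('a set \<Rightarrow> nat) \<Rightarrow> bool" where
  "VCEW G k w \<longleftrightarrow> edge_weighting G k w \<and> proper_coloring G (induced_coloring G w)"

definition admits_VCEW :: "'a sgraph \<Rightarrow> nat \<Rightarrow> bool" where
  "admits_VCEW G k \<longleftrightarrow> (\<exists>w. VCEW G k w)"

text \<open>
  The value is \<open>\<infinity>\<close> if no \<open>k\<close> works (as for \<open>K\<^sub>2\<close>), so an equation \<open>mu G = 2\<close>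
  includes the existence of a vertex-coloring 2-edge-weighting.
\<close>

definition mu :: "'a sgraph \<Rightarrow> enat" where
  "mu G = Inf (enat ` {k. admits_VCEW G k})"

definition box_product :: "'a sgraph \<Rightarrow> 'b sgraph \<Rightarrow> ('a \<times> 'b) sgraph" (infixr "\<box>" 70) where
  "G \<box> H =
     \<lparr> vertices = vertices G \<times> vertices H,
       edges = {{(u, v), (u, v')} | u v v'. u \<in> vertices G \<and> {v, v'} \<in> edges H}
             \<union> {{(u, v), (u', v)} | u u' v. {u, u'} \<in> edges G \<and> v \<in> vertices H} \<rparr>"

definition path_graph :: "nat \<Rightarrow> nat sgraph" where
  "path_graph n = \<lparr> vertices = {..<n}, edges = {{i, i + 1} | i. i + 1 < n} \<rparr>"

definition cycle_graph :: "nat \<Rightarrow> nat sgraph" where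
  "cycle_graph n = \<lparr> vertices = {..<n}, edges = {{i, (i + 1) mod n} | i. i < n} \<rparr>"

definition complete_graph :: "nat \<Rightarrow> nat sgraph" where
  "complete_graph n =
     \<lparr> vertices = {..<n}, edges = {{i, j} | i j. i < n \<and> j < n \<and> i \<noteq> j} \<rparr>"

definition relabel :: "('a \<Rightarrow> 'b) \<Rightarrow> 'a sgraph \<Rightarrow> 'b sgraph" where
  "relabel f G = \<lparr> vertices = f ` vertices G, edges = (\<lambda>e. f ` e) ` edges G \<rparr>"

text \<open>
  The type of an iterated product depends on the number of factors. The cube is therefore
  built by writing the vertices of the product as lists; the relabelling is injective,
  and the empty product is the one-vertex graph.
\<close>

primrec cube_graph :: "nat \<Rightarrow> nat list sgraph" where
  "cube_graph 0 = \<lparr> vertices = {[]}, edges = {} \<rparr>"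
| "cube_graph (Suc n) = relabel (\<lambda>(x, xs). x # xs) (complete_graph 2 \<box> cube_graph n)"

end

theory Submission
  imports Defs
begin

text \<open>
  That the invariant is at least \<open>2\<close> comes from degrees: all weights \<open>1\<close> give the degree
  colouring, and two adjacent vertices of equal degree in one factor remain adjacent with equal
  degree in the product. The work lies in finding weights \<open>1\<close> and \<open>2\<close>, and there it pays to
  speak of the set \<open>F\<close> of the edges of weight \<open>1\<close>: the colour of \<open>v\<close> is then twice its
  degree minus the number of edges of \<open>F\<close> at \<open>v\<close>, so the parity of the colour is the parity of
  \<open>F\<close> at \<open>v\<close>. In a connected graph every vertex set \<open>T\<close> of even size is the set of odd
  vertices of some \<open>F\<close> (\<open>ex_join\<close>). Consequently a connected bipartite graph with a part of
  even size can be coloured so that the two parts get different parities.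

  The difficult products are those with two odd parts \<open>A\<close> and \<open>B\<close>. There a vertex \<open>v \<in> A\<close> is
  given the parity of \<open>B\<close>. This leaves \<open>A - {v}\<close>, of even size, as the set of odd vertices, and
  conflicts are possible only between \<open>v\<close> and its neighbours. All edges at \<open>v\<close> get weight \<open>2\<close>;
  each neighbour \<open>u\<close> of \<open>v\<close> gets an even number of edges of weight \<open>1\<close>, chosen by hand so that
  its colour differs from that of \<open>v\<close>, and the parities at the remaining vertices are then
  corrected inside a connected part \<open>R\<close> of the graph which avoids \<open>v\<close> and its neighbours
  (\<open>admits_VCEW_2_if_repairable\<close>). It remains to choose \<open>v\<close>.

  \<^item> If both factors have at least three vertices, \<open>v\<close> is a pair of vertices neither of which
    disconnects its factor. Removing \<open>v\<close> with its neighbours then leaves the product connected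
    (\<open>admits_VCEW_2_box_large\<close>).

  \<^item> If one factor is \<open>K\<^sub>2\<close>, with vertices \<open>p\<close> and \<open>q\<close>, such a pair may have to consist of \<open>p\<close> and
    a leaf of the other factor \<open>H\<close>, and then \<open>v\<close> always conflicts with its copy over \<open>q\<close>. Here
    \<open>v = (p, y)\<close> where \<open>y\<close> does not disconnect the graph that \<open>H\<close> becomes when its leaves are
    deleted. The leaves at \<open>y\<close> are the only obstacle to connectedness, and their edges are all
    prescribed (\<open>admits_VCEW_2_box_K2\<close>).
\<close>

section \<open>Degrees and colours\<close>

text \<open>
  Taking an edge set instead of a graph as argument lets one notion serve both for the
  neighbourhood in the graph and for the other ends of the edges of weight \<open>1\<close> at a vertex.
\<close>
definition nbrs :: "'a set set \<Rightarrow> 'a \<Rightarrow> 'a set" where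
  "nbrs F v = {u. {v, u} \<in> F}"

lemma nbrs_sym: "u \<in> nbrs F v \<longleftrightarrow> v \<in> nbrs F u"
  by (simp add: nbrs_def insert_commute)

lemma adjacent_nbrs: "adjacent G u v \<longleftrightarrow> v \<in> nbrs (edges G) u"
  by (simp add: adjacent_def nbrs_def)

lemma adjacent_sym: "adjacent G u v \<Longrightarrow> adjacent G v u"
  by (simp add: adjacent_def insert_commute)

lemma adjacentD:
  assumes "simple_graph G" "adjacent G u v"
  shows "u \<in> vertices G" "v \<in> vertices G" "u \<noteq> v"
proof -
  have "{u, v} \<subseteq> vertices G \<and> card {u, v} = 2"
    using assms unfolding simple_graph_def adjacent_def by blast
  then show "u \<in> vertices G" "v \<in> vertices G" "u \<noteq> v"
    by (auto simp: card_insert_if split: if_splits)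
qed

lemma nbrs_subset: "simple_graph G \<Longrightarrow> nbrs (edges G) v \<subseteq> vertices G - {v}"
  by (metis DiffI adjacentD(2,3) adjacent_nbrs singletonD subsetI)

lemma finite_nbrs: "simple_graph G \<Longrightarrow> F \<subseteq> edges G \<Longrightarrow> finite (nbrs F v)"
  by (rule finite_subset[of _ "vertices G"])
     (use nbrs_subset[of G v] in \<open>auto simp: nbrs_def simple_graph_def\<close>)

lemma edges_at_eq_image:
  assumes "simple_graph G"
  shows "{e. e \<in> edges G \<and> v \<in> e} = (\<lambda>u. {v, u}) ` nbrs (edges G) v"
proof (intro equalityI subsetI)
  fix e assume "e \<in> {e. e \<in> edges G \<and> v \<in> e}"
  then have e: "e \<in> edges G" "v \<in> e" by auto
  then have "card e = 2" using assms by (auto simp: simple_graph_def)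
  then obtain a b where "e = {a, b}" by (auto simp: card_2_iff)
  then show "e \<in> (\<lambda>u. {v, u}) ` nbrs (edges G) v"
    using e by (auto simp: nbrs_def insert_commute)
qed (auto simp: nbrs_def)

lemma induced_coloring_nbrs:
  assumes "simple_graph G"
  shows "induced_coloring G w v = (\<Sum>u\<in>nbrs (edges G) v. w {v, u})"
  unfolding induced_coloring_def edges_at_eq_image[OF assms]
  by (subst sum.reindex) (auto simp: inj_on_def doubleton_eq_iff)

text \<open>
  An edge contributes \<open>2\<close> to the colour of its end, except that membership in \<open>F\<close> costs \<open>1\<close>; the
  identity is in additive form to avoid truncated subtraction.
\<close>
lemma induced_coloring_one_two:
  assumes "simple_graph G" "F \<subseteq> edges G"
  shows "induced_coloring G (\<lambda>e. if e \<in> F then 1 else 2) v + card (nbrs F v)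
       = 2 * card (nbrs (edges G) v)"
proof -
  let ?N = "nbrs (edges G) v"
  have fin: "finite ?N" using finite_nbrs[OF assms(1)] by blast
  have "nbrs F v = {u \<in> ?N. {v, u} \<in> F}" using assms(2) by (auto simp: nbrs_def)
  then have "card (nbrs F v) = (\<Sum>u\<in>?N. if {v, u} \<in> F then 1 else 0)"
    using fin by (simp add: sum.If_cases Int_def)
  then have "induced_coloring G (\<lambda>e. if e \<in> F then 1 else 2) v + card (nbrs F v)
     = (\<Sum>u\<in>?N. (if {v, u} \<in> F then 1 else 2) + (if {v, u} \<in> F then 1 else 0))"
    by (simp add: induced_coloring_nbrs[OF assms(1)] sum.distrib)
  also have "\<dots> = (\<Sum>u\<in>?N. 2)" by (rule sum.cong) auto
  finally show ?thesis by simp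
qed

text \<open>The only 1-edge-weighting is constant, and its colours are the degrees.\<close>
lemma not_admits_VCEW_1_iff:
  assumes "simple_graph G"
  shows "\<not> admits_VCEW G 1 \<longleftrightarrow>
    (\<exists>u v. adjacent G u v \<and> card (nbrs (edges G) u) = card (nbrs (edges G) v))"
proof -
  have "induced_coloring G w v = card (nbrs (edges G) v)" if "edge_weighting G 1 w" for w v
    using that by (auto simp: induced_coloring_nbrs[OF assms] edge_weighting_def nbrs_def)
  then have "VCEW G 1 w \<longleftrightarrow> edge_weighting G 1 w \<and>
      (\<forall>u v. adjacent G u v \<longrightarrow> card (nbrs (edges G) u) \<noteq> card (nbrs (edges G) v))" for w
    by (auto simp: VCEW_def proper_coloring_def)
  moreover have "edge_weighting G 1 (\<lambda>_. 1)" by (simp add: edge_weighting_def)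
  ultimately show ?thesis unfolding admits_VCEW_def by blast
qed


lemma not_admits_VCEW_0: "edges G \<noteq> {} \<Longrightarrow> \<not> admits_VCEW G 0"
  by (auto simp: admits_VCEW_def VCEW_def edge_weighting_def)

text \<open>
  The value \<open>0\<close> is excluded from the infimum because an edge cannot get a weight from the empty
  set \<open>{1..0}\<close>.
\<close>
lemma mu_eq_2I:
  assumes "edges G \<noteq> {}" "\<not> admits_VCEW G 1" "admits_VCEW G 2"
  shows "mu G = 2"
  unfolding mu_def
proof (rule antisym)
  have "enat 2 \<in> enat ` {k. admits_VCEW G k}" using assms(3) by blast
  then show "Inf (enat ` {k. admits_VCEW G k}) \<le> 2"
    by (metis Inf_lower numeral_eq_enat)
  show "2 \<le> Inf (enat ` {k. admits_VCEW G k})"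
  proof (rule Inf_greatest)
    fix x assume "x \<in> enat ` {k. admits_VCEW G k}"
    then obtain k where k: "x = enat k" "admits_VCEW G k" by blast
    have "k \<noteq> 0" "k \<noteq> 1" using k(2) assms(2) not_admits_VCEW_0[OF assms(1)] by metis+
    then have "2 \<le> k" by simp
    then show "2 \<le> x" by (simp add: k(1) numeral_eq_enat)
  qed
qed

section \<open>Parity subgraphs of connected graphs\<close>

text \<open>
  Connectedness is formulated for vertex subsets so that vertices can be deleted without building
  subgraphs. The empty set counts as connected, which spares case distinctions when everything
  has been deleted.
\<close>
definition connected_on :: "'a sgraph \<Rightarrow> 'a set \<Rightarrow> bool" where
  "connected_on G W \<longleftrightarrow>
     (\<forall>u\<in>W. \<forall>v\<in>W. (\<lambda>x y. adjacent G x y \<and> x \<in> W \<and> y \<in> W)\<^sup>*\<^sup>* u v)"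

lemma connected_onI_root:
  assumes "\<And>u. u \<in> W \<Longrightarrow> (\<lambda>x y. adjacent G x y \<and> x \<in> W \<and> y \<in> W)\<^sup>*\<^sup>* r u"
  shows "connected_on G W"
proof -
  let ?R = "\<lambda>x y. adjacent G x y \<and> x \<in> W \<and> y \<in> W"
  have "symp ?R" by (auto simp: symp_def adjacent_sym)
  then have "symp ?R\<^sup>*\<^sup>*" by (rule symp_rtranclp)
  then show ?thesis unfolding connected_on_def
    using assms by (meson rtranclp_trans sympD)
qed

lemma connected_on_vertices_iff:
  assumes "simple_graph G"
  shows "connected_on G (vertices G) \<longleftrightarrow>
    (\<forall>u\<in>vertices G. \<forall>v\<in>vertices G. (adjacent G)\<^sup>*\<^sup>* u v)"
proof -
  have "(\<lambda>x y. adjacent G x y \<and> x \<in> vertices G \<and> y \<in> vertices G) = adjacent G"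
    using adjacentD[OF assms] by (auto simp: fun_eq_iff)
  then show ?thesis unfolding connected_on_def by simp
qed

lemma connected_on_extend:
  assumes "connected_on G W" "W \<subseteq> W'"
    and "\<And>x. x \<in> W' - W \<Longrightarrow> \<exists>w\<in>W. adjacent G x w"
  shows "connected_on G W'"
proof (cases "W = {}")
  case True
  then show ?thesis using assms(3) by (auto simp: connected_on_def)
next
  case False
  then obtain r where r: "r \<in> W" by blast
  let ?R = "\<lambda>W x y. adjacent G x y \<and> x \<in> W \<and> y \<in> W"
  have inW: "(?R W')\<^sup>*\<^sup>* r u" if "u \<in> W" for u
  proof -
    have "(?R W)\<^sup>*\<^sup>* r u" using assms(1) r that by (auto simp: connected_on_def)
    moreover have "?R W \<le> ?R W'" using assms(2) by auto
    ultimately show ?thesis using rtranclp_mono by blast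
  qed
  show ?thesis
  proof (rule connected_onI_root)
    fix u assume u: "u \<in> W'"
    show "(?R W')\<^sup>*\<^sup>* r u"
    proof (cases "u \<in> W")
      case False
      then obtain w where w: "w \<in> W" "adjacent G u w" using assms(3) u by blast
      then have "?R W' w u" using u assms(2) by (auto simp: adjacent_sym)
      with inW[OF w(1)] show ?thesis by (rule rtranclp.rtrancl_into_rtrancl)
    qed (rule inW)
  qed
qed

lemma connected_on_boundary:
  assumes "connected_on G W" "C \<subseteq> W" "C \<noteq> {}" "C \<noteq> W"
  obtains x c where "c \<in> C" "x \<in> W - C" "adjacent G x c"
proof -
  obtain a b where a: "a \<in> C" and b: "b \<in> W" "b \<notin> C" using assms by blast
  have "(\<lambda>x y. adjacent G x y \<and> x \<in> W \<and> y \<in> W)\<^sup>*\<^sup>* a b"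
    using assms(1,2) a b by (auto simp: connected_on_def)
  then have "b \<notin> C \<longrightarrow> (\<exists>c\<in>C. \<exists>x\<in>W - C. adjacent G x c)"
  proof (induction rule: rtranclp_induct)
    case (step y z)
    then show ?case using adjacent_sym[of G y z] by blast
  qed (simp add: a)
  then show ?thesis using that b by blast
qed

text \<open>
  A largest connected proper subset must miss exactly one vertex, since otherwise a vertex at its
  boundary could be added to it.
\<close>
lemma connected_on_remove_vertex:
  assumes "finite W" "W \<noteq> {}" "connected_on G W"
  obtains g where "g \<in> W" "connected_on G (W - {g})"
proof -
  let ?P = "\<lambda>C. C \<subset> W \<and> connected_on G C"
  have "?P {}" using assms(2) by (auto simp: connected_on_def)
  moreover have "\<forall>C. ?P C \<longrightarrow> card C < card W"
    using assms(1) by (simp add: psubset_card_mono)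
  ultimately have "\<exists>C. ?P C \<and> (\<forall>D. ?P D \<longrightarrow> card D \<le> card C)"
    using ex_has_greatest_nat[of ?P "{}" card "card W"] by presburger
  then obtain C where C: "?P C" and max: "\<And>D. ?P D \<Longrightarrow> card D \<le> card C"
    by blast
  have finC: "finite C" using C assms(1) finite_subset by blast
  obtain x where x: "x \<in> W - C" "connected_on G (insert x C)"
  proof (cases "C = {}")
    case True
    then show ?thesis using assms(2) that by (auto simp: connected_on_def)
  next
    case False
    obtain c x where cx: "c \<in> C" "x \<in> W - C" "adjacent G x c"
      using connected_on_boundary[OF assms(3) _ False] C by blast
    have "connected_on G (insert x C)"
    proof (rule connected_on_extend[of G C])
      show "\<exists>w\<in>C. adjacent G y w" if "y \<in> insert x C - C" for y
        using that cx by blast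
    qed (use C in auto)
    then show ?thesis using that cx by blast
  qed
  have "insert x C = W"
  proof (rule ccontr)
    assume "insert x C \<noteq> W"
    then have "?P (insert x C)" using C x by blast
    then have "card (insert x C) \<le> card C" by (rule max)
    then show False using x(1) finC by simp
  qed
  then have "W - {x} = C" using x(1) by blast
  then show ?thesis using that[of x] x(1) C by simp
qed

lemma odd_card_sym_diff:
  assumes "finite A" "finite B"
  shows "odd (card (sym_diff A B)) \<longleftrightarrow> (odd (card A) \<noteq> odd (card B))"
proof -
  have "card (sym_diff A B) = card (A - B) + card (B - A)"
    using assms by (intro card_Un_disjoint) auto
  moreover have "card A = card (A - B) + card (A \<inter> B)" "card B = card (B - A) + card (A \<inter> B)"
    using assms by (metis card_Diff_subset_Int card_mono finite_Int inf_le1 le_add_diff_inverse2 inf_commute)+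
  ultimately show ?thesis by auto
qed

lemma nbrs_sym_diff: "nbrs (sym_diff F F') v = sym_diff (nbrs F v) (nbrs F' v)"
  by (auto simp: nbrs_def)

lemma odd_nbrs_sym_diff:
  assumes "simple_graph G" "F \<subseteq> edges G" "F' \<subseteq> edges G"
  shows "odd (card (nbrs (sym_diff F F') v)) \<longleftrightarrow> (odd (card (nbrs F v)) \<noteq> odd (card (nbrs F' v)))"
  unfolding nbrs_sym_diff using assms by (intro odd_card_sym_diff finite_nbrs)

text \<open>
  Adding the edges of a walk modulo 2 changes the parity at its two ends only, even if the walk
  repeats edges; for \<open>a = b\<close> no vertex is odd.
\<close>
lemma ex_path_join:
  assumes "simple_graph G" "connected_on G W" "a \<in> W" "b \<in> W"
  shows "\<exists>F \<subseteq> {e \<in> edges G. e \<subseteq> W}. \<forall>v. odd (card (nbrs F v)) \<longleftrightarrow> ((v = a) \<noteq> (v = b))"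
proof -
  have "(\<lambda>x y. adjacent G x y \<and> x \<in> W \<and> y \<in> W)\<^sup>*\<^sup>* a b"
    using assms by (auto simp: connected_on_def)
  then show ?thesis
  proof (induction rule: rtranclp_induct)
    case base
    show ?case by (rule exI[of _ "{}"]) (auto simp: nbrs_def)
  next
    case (step y z)
    then obtain F where F: "F \<subseteq> {e \<in> edges G. e \<subseteq> W}"
      "\<And>v. odd (card (nbrs F v)) \<longleftrightarrow> ((v = a) \<noteq> (v = y))" by blast
    have yz: "{y, z} \<in> edges G" "{y, z} \<subseteq> W" "y \<noteq> z"
      using step.hyps adjacentD[OF assms(1)] by (auto simp: adjacent_def)
    have "nbrs {{y, z}} v = (if v = y then {z} else if v = z then {y} else {})" for v
      using yz(3) by (auto simp: nbrs_def doubleton_eq_iff)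
    then have "odd (card (nbrs {{y, z}} v)) \<longleftrightarrow> ((v = y) \<noteq> (v = z))" for v
      using yz(3) by simp
    moreover have "F \<subseteq> edges G" "{{y, z}} \<subseteq> edges G" using F(1) yz(1) by auto
    ultimately have "odd (card (nbrs (sym_diff F {{y, z}}) v)) \<longleftrightarrow> ((v = a) \<noteq> (v = z))" for v
      using odd_nbrs_sym_diff[OF assms(1), of F "{{y, z}}" v] F(2)[of v] by auto
    moreover have "sym_diff F {{y, z}} \<subseteq> {e \<in> edges G. e \<subseteq> W}" using F(1) yz by auto
    ultimately show ?case by blast
  qed
qed

text \<open>Pair up the vertices of \<open>T\<close> and add the walks that join the pairs modulo 2.\<close>
lemma ex_join:
  assumes "simple_graph G" "connected_on G W" "finite T" "T \<subseteq> W" "even (card T)"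
  shows "\<exists>F \<subseteq> {e \<in> edges G. e \<subseteq> W}. \<forall>v. odd (card (nbrs F v)) \<longleftrightarrow> v \<in> T"
  using assms(3-5)
proof (induction "card T" arbitrary: T rule: less_induct)
  case less
  show ?case
  proof (cases "T = {}")
    case True
    then show ?thesis by (intro exI[of _ "{}"]) (auto simp: nbrs_def)
  next
    case False
    then obtain a where a: "a \<in> T" by blast
    have "T \<noteq> {a}" using less.prems(3) by auto
    then obtain b where b: "b \<in> T" "a \<noteq> b" using a by blast
    let ?T = "T - {a, b}"
    have card: "card T = card ?T + 2"
      using card_Diff_subset[of "{a, b}" T] card_mono[of T "{a, b}"] a b less.prems(1) by auto
    then have "\<exists>F \<subseteq> {e \<in> edges G. e \<subseteq> W}. \<forall>v. odd (card (nbrs F v)) \<longleftrightarrow> v \<in> ?T"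
      using less.prems by (intro less.hyps) auto
    then obtain F where F: "F \<subseteq> {e \<in> edges G. e \<subseteq> W}"
      "\<And>v. odd (card (nbrs F v)) \<longleftrightarrow> v \<in> ?T" by blast
    obtain P where P: "P \<subseteq> {e \<in> edges G. e \<subseteq> W}"
      "\<And>v. odd (card (nbrs P v)) \<longleftrightarrow> ((v = a) \<noteq> (v = b))"
      using ex_path_join[OF assms(1,2), of a b] a b less.prems(2) by blast
    have "F \<subseteq> edges G" "P \<subseteq> edges G" using F(1) P(1) by auto
    then have "odd (card (nbrs (sym_diff F P) v)) \<longleftrightarrow> v \<in> T" for v
      using odd_nbrs_sym_diff[OF assms(1), of F P v] F(2)[of v] P(2)[of v] a b by auto
    moreover have "sym_diff F P \<subseteq> {e \<in> edges G. e \<subseteq> W}" using F(1) P(1) by auto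
    ultimately show ?thesis by blast
  qed
qed

section \<open>Weightings from parity subgraphs\<close>

definition bipartition :: "'a sgraph \<Rightarrow> 'a set \<Rightarrow> 'a set \<Rightarrow> bool" where
  "bipartition G A B \<longleftrightarrow> A \<inter> B = {} \<and> A \<union> B = vertices G \<and>
     (\<forall>e\<in>edges G. \<exists>x\<in>A. \<exists>y\<in>B. e = {x, y})"

lemma bipartition_swap: "bipartition G A B \<Longrightarrow> bipartition G B A"
  unfolding bipartition_def by (metis Int_commute Un_commute insert_commute)

lemma bipartite_graph_iff: "bipartite_graph G \<longleftrightarrow> (\<exists>A B. bipartition G A B)"
  by (simp add: bipartite_graph_def bipartition_def)

lemma bipartition_adjacent:
  assumes "bipartition G A B" "adjacent G u v"
  shows "u \<in> A \<and> v \<in> B \<and> u \<notin> B \<and> v \<notin> A \<or> u \<in> B \<and> v \<in> A \<and> u \<notin> A \<and> v \<notin> B"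
proof -
  obtain x y where "x \<in> A" "y \<in> B" "{u, v} = {x, y}"
    using assms unfolding bipartition_def adjacent_def by metis
  then show ?thesis using assms(1) by (auto simp: bipartition_def doubleton_eq_iff)
qed

text \<open>
  The inequality says that the colours \<open>2 * deg u - |F at u|\<close> and \<open>2 * deg v - |F at v|\<close> differ.
\<close>
lemma admits_VCEW_2I:
  assumes "simple_graph G" "F \<subseteq> edges G"
    and "\<And>u v. adjacent G u v \<Longrightarrow>
      2 * card (nbrs (edges G) u) + card (nbrs F v) \<noteq> 2 * card (nbrs (edges G) v) + card (nbrs F u)"
  shows "admits_VCEW G 2"
proof -
  let ?w = "\<lambda>e. if e \<in> F then 1 else 2 :: nat"
  have "induced_coloring G ?w u \<noteq> induced_coloring G ?w v" if "adjacent G u v" for u v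
    using assms(3)[OF that] induced_coloring_one_two[OF assms(1,2), of u]
      induced_coloring_one_two[OF assms(1,2), of v] by linarith
  then have "VCEW G 2 ?w" by (auto simp: VCEW_def edge_weighting_def proper_coloring_def)
  then show ?thesis unfolding admits_VCEW_def by blast
qed

text \<open>An edge set that is odd exactly on \<open>A\<close> makes the colours odd on \<open>A\<close> and even on \<open>B\<close>.\<close>
lemma admits_VCEW_2_if_even_part:
  assumes "simple_graph G" "connected_on G (vertices G)" "bipartition G A B" "even (card A)"
  shows "admits_VCEW G 2"
proof -
  have "A \<subseteq> vertices G" using assms(3) by (auto simp: bipartition_def)
  moreover have "finite A" using calculation assms(1) finite_subset by (auto simp: simple_graph_def)
  ultimately obtain F where F: "F \<subseteq> edges G" "\<And>v. odd (card (nbrs F v)) \<longleftrightarrow> v \<in> A"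
    using ex_join[OF assms(1,2), of A] assms(4) by blast
  show ?thesis
  proof (rule admits_VCEW_2I[OF assms(1) F(1)])
    fix u v assume "adjacent G u v"
    then have "odd (card (nbrs F u)) \<noteq> odd (card (nbrs F v))"
      using bipartition_adjacent[OF assms(3)] F(2) by blast
    then show "2 * card (nbrs (edges G) u) + card (nbrs F v)
      \<noteq> 2 * card (nbrs (edges G) v) + card (nbrs F u)" by presburger
  qed
qed

text \<open>
  The exceptional vertex \<open>v\<close> has all its edges of weight \<open>2\<close>. For a neighbour \<open>u\<close> of \<open>v\<close>, the set
  \<open>S u\<close> lists the other ends of the weight-1 edges at \<open>u\<close>, and the inequality for \<open>u\<close>
  says that \<open>u\<close> and \<open>v\<close> get different colours. The parities inside \<open>R\<close> can be corrected freely
  because \<open>R\<close> is connected. A vertex outside \<open>R\<close>, not adjacent or equal to \<open>v\<close>, must get the right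
  parity from the prescribed edges alone. The number of vertices still to be corrected is even:
  \<open>A - {v}\<close> has even size and the prescribed edges meet it in \<open>\<Sum>u. card (S u)\<close> ends.
\<close>
lemma admits_VCEW_2_if_repairable:
  assumes G: "simple_graph G" and bip: "bipartition G A B" and odd: "odd (card A)"
    and v: "v \<in> A" and R: "R \<subseteq> vertices G - insert v (nbrs (edges G) v)" "connected_on G R"
    and S: "\<And>u. u \<in> nbrs (edges G) v \<Longrightarrow> S u \<subseteq> nbrs (edges G) u - {v}"
      "\<And>u. u \<in> nbrs (edges G) v \<Longrightarrow> even (card (S u))"
    and noconf: "\<And>u. u \<in> nbrs (edges G) v \<Longrightarrow>
      2 * card (nbrs (edges G) u) \<noteq> 2 * card (nbrs (edges G) v) + card (S u)"
    and Q: "\<And>q. q \<in> vertices G - insert v (nbrs (edges G) v) - R \<Longrightarrow>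
      q \<in> A \<and> odd (card {u \<in> nbrs (edges G) v. q \<in> S u})"
  shows "admits_VCEW G 2"
proof -
  let ?N = "nbrs (edges G) v"
  define E0 where "E0 = {{u, s} | u s. u \<in> ?N \<and> s \<in> S u}"
  have AB: "A \<inter> B = {}" "A \<union> B = vertices G" using bip by (simp_all add: bipartition_def)
  have finV: "finite (vertices G)" using G by (simp add: simple_graph_def)
  have finA: "finite A" using finV AB(2) by (metis finite_Un)
  have finN: "finite ?N" using finite_nbrs[OF G] by blast
  have NB: "u \<in> B \<and> u \<notin> A" if "u \<in> ?N" for u
    using bipartition_adjacent[OF bip, of v u] v that AB(1) by (auto simp: adjacent_nbrs)
  have SA: "s \<in> A \<and> s \<notin> B \<and> s \<noteq> v" if "u \<in> ?N" "s \<in> S u" for u s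
    using bipartition_adjacent[OF bip, of u s] NB[OF that(1)] that S(1)[OF that(1)]
    by (auto simp: adjacent_nbrs)
  have E0: "E0 \<subseteq> edges G" using S(1) by (auto simp: E0_def nbrs_def)
  have E0_iff: "x \<in> nbrs E0 q \<longleftrightarrow> q \<in> ?N \<and> x \<in> S q \<or> x \<in> ?N \<and> q \<in> S x" for q x
  proof -
    have "x \<in> nbrs E0 q \<longleftrightarrow> (\<exists>u s. u \<in> ?N \<and> s \<in> S u \<and> {q, x} = {u, s})"
      unfolding nbrs_def[of E0 q] mem_Collect_eq by (auto simp: E0_def)
    then show ?thesis unfolding doubleton_eq_iff by blast
  qed
  have E0_N: "nbrs E0 u = S u" if "u \<in> ?N" for u
    using that NB SA E0_iff by blast
  have E0_A: "nbrs E0 q = {u \<in> ?N. q \<in> S u}" if "q \<in> A" for q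
    using that NB SA E0_iff by blast
  have E0_B: "nbrs E0 q = {}" if "q \<in> B" "q \<notin> ?N" for q
    using that NB SA E0_iff by blast
  have E0_v: "nbrs E0 v = {}" using E0_A[OF v] SA by blast
  \<comment> \<open>These are the vertices of \<open>A - {v}\<close> that the prescribed edges leave even.\<close>
  define T where "T = {x \<in> A - {v}. even (card (nbrs E0 x))}"
  have "T \<subseteq> R"
  proof
    fix x assume "x \<in> T"
    then have x: "x \<in> A" "x \<noteq> v" "even (card (nbrs E0 x))" by (auto simp: T_def)
    show "x \<in> R"
    proof (rule ccontr)
      assume "x \<notin> R"
      then have "x \<in> vertices G - insert v ?N - R" using x NB AB by blast
      then show False using Q x(3) E0_A[OF x(1)] by simp
    qed
  qed
  \<comment> \<open>Every prescribed edge joins a neighbour of \<open>v\<close> to a vertex of \<open>A - {v}\<close>; count both ways.\<close>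
  have "(\<Sum>x\<in>A - {v}. card (nbrs E0 x)) = (\<Sum>x\<in>A - {v}. \<Sum>u\<in>?N. if x \<in> S u then 1 else 0)"
    using finN by (intro sum.cong) (auto simp: E0_A sum.If_cases Int_def)
  also have "\<dots> = (\<Sum>u\<in>?N. \<Sum>x\<in>A - {v}. if x \<in> S u then 1 else 0)" by (rule sum.swap)
  also have "\<dots> = (\<Sum>u\<in>?N. card (S u))"
  proof (rule sum.cong)
    fix u assume "u \<in> ?N"
    then have "S u = {x \<in> A - {v}. x \<in> S u}" using SA by blast
    then show "(\<Sum>x\<in>A - {v}. if x \<in> S u then 1 else 0) = card (S u)"
      using finA by (simp add: sum.If_cases Int_def)
  qed simp
  finally have "even (\<Sum>x\<in>A - {v}. card (nbrs E0 x))" using S(2) by (simp add: dvd_sum)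
  then have "even (card {x \<in> A - {v}. odd (card (nbrs E0 x))})"
    using finA by (simp add: even_sum_iff)
  moreover have "card (A - {v}) = card T + card {x \<in> A - {v}. odd (card (nbrs E0 x))}"
    unfolding T_def using finA by (subst card_Un_disjoint[symmetric]) (auto intro: arg_cong[of _ _ card])
  moreover have "even (card (A - {v}))" using odd v finA by simp
  ultimately have "even (card T)" by simp
  moreover have "finite T" using finA by (simp add: T_def)
  ultimately obtain J where J: "J \<subseteq> {e \<in> edges G. e \<subseteq> R}"
    "\<And>x. odd (card (nbrs J x)) \<longleftrightarrow> x \<in> T"
    using ex_join[OF G R(2) _ \<open>T \<subseteq> R\<close>] by blast
  define F where "F = sym_diff E0 J"
  have F: "F \<subseteq> edges G" using E0 J(1) by (auto simp: F_def)
  have F_out: "nbrs F x = nbrs E0 x" if "x \<notin> R" for x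
    using that J(1) by (auto simp: F_def nbrs_def)
  have F_v: "nbrs F v = {}" using F_out[of v] E0_v R(1) by blast
  have F_N: "nbrs F u = S u" if "u \<in> ?N" for u
    using F_out[of u] E0_N[OF that] R(1) that by blast
  have parity: "odd (card (nbrs F x)) \<longleftrightarrow> x \<in> A - {v}" if "x \<in> vertices G" for x
  proof -
    have J': "J \<subseteq> edges G" using J(1) by blast
    have "odd (card (nbrs F x)) \<longleftrightarrow> (odd (card (nbrs E0 x)) \<noteq> (x \<in> T))"
      unfolding F_def using odd_nbrs_sym_diff[OF G E0 J', of x] J(2) by simp
    moreover have "even (card (nbrs E0 x)) \<and> x \<notin> T" if "x \<in> B"
      using that E0_B[of x] E0_N[of x] S(2)[of x] AB(1) by (cases "x \<in> ?N") (auto simp: T_def)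
    moreover have "even (card (nbrs E0 x)) \<and> x \<notin> T" if "x = v"
      using that E0_v by (simp add: T_def)
    moreover have "odd (card (nbrs E0 x)) \<noteq> (x \<in> T)" if "x \<in> A - {v}"
      using that by (auto simp: T_def)
    ultimately show ?thesis using that AB by blast
  qed
  show ?thesis
  proof (rule admits_VCEW_2I[OF G F])
    let ?neq = "\<lambda>a b. 2 * card (nbrs (edges G) a) + card (nbrs F b)
      \<noteq> 2 * card (nbrs (edges G) b) + card (nbrs F a)"
    have from_A: "?neq a b" if "adjacent G a b" "a \<in> A" "b \<notin> A" for a b
    proof (cases "a = v")
      case True
      then have "b \<in> ?N" using that by (simp add: adjacent_nbrs)
      then show ?thesis using noconf[of b] F_N[of b] F_v True by simp
    next
      case False
      then have "odd (card (nbrs F a))" "even (card (nbrs F b))"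
        using parity adjacentD[OF G that(1)] that by auto
      then show ?thesis by presburger
    qed
    fix a b assume ab: "adjacent G a b"
    then show "?neq a b"
      using bipartition_adjacent[OF bip ab] from_A[of a b] from_A[of b a] adjacent_sym[OF ab]
      by metis
  qed
qed

text \<open>
  When everything beyond the neighbours of \<open>v\<close> is connected, the sets \<open>S u\<close> can be arbitrary of
  even size. A neighbour \<open>u\<close> with all edges of weight \<open>2\<close> conflicts with \<open>v\<close> only if the degrees
  agree, and then two of its edges are given weight \<open>1\<close>. These must differ from the edge \<open>uv\<close>,
  whence the bound \<open>3\<close> on the degree.
\<close>
lemma admits_VCEW_2_if_rest_connected:
  assumes G: "simple_graph G" and bip: "bipartition G A B" and odd: "odd (card A)"
    and v: "v \<in> A" and R: "connected_on G (vertices G - insert v (nbrs (edges G) v))"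
    and deg: "\<And>u. u \<in> nbrs (edges G) v \<Longrightarrow> card (nbrs (edges G) u) = card (nbrs (edges G) v) \<Longrightarrow>
      3 \<le> card (nbrs (edges G) v)"
  shows "admits_VCEW G 2"
proof -
  let ?d = "\<lambda>u. card (nbrs (edges G) u)"
  have "\<exists>P. P \<subseteq> nbrs (edges G) u - {v} \<and> card P = (if ?d u = ?d v then 2 else 0)"
    if "u \<in> nbrs (edges G) v" for u
  proof -
    have "card (nbrs (edges G) u - {v}) = ?d u - 1"
      using that by (simp add: nbrs_sym)
    then have "(if ?d u = ?d v then 2 else 0) \<le> card (nbrs (edges G) u - {v})"
      using deg[OF that] by (cases "?d u = ?d v") auto
    then obtain P where "P \<subseteq> nbrs (edges G) u - {v}" "card P = (if ?d u = ?d v then 2 else 0)"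
      by (rule obtain_subset_with_card_n)
    then show ?thesis by blast
  qed
  then obtain S where S: "\<And>u. u \<in> nbrs (edges G) v \<Longrightarrow>
      S u \<subseteq> nbrs (edges G) u - {v} \<and> card (S u) = (if ?d u = ?d v then 2 else 0)"
    by metis
  show ?thesis
    by (rule admits_VCEW_2_if_repairable[OF G bip odd v subset_refl R, of S]) (use S in auto)
qed

section \<open>Leaves of connected graphs\<close>

lemma ex_nbr:
  assumes "connected_on G (vertices G)" "2 \<le> card (vertices G)" "v \<in> vertices G"
  obtains u where "adjacent G v u"
proof -
  have "vertices G \<noteq> {v}" using assms(2) by auto
  then obtain x where "adjacent G x v"
    using connected_on_boundary[OF assms(1), of "{v}"] assms(3) by blast
  then show ?thesis using that adjacent_sym by metis
qed

lemma nbrs_card_pos: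
  assumes "simple_graph G" "connected_on G (vertices G)" "2 \<le> card (vertices G)" "v \<in> vertices G"
  shows "1 \<le> card (nbrs (edges G) v)"
proof -
  obtain u where "u \<in> nbrs (edges G) v" using ex_nbr[OF assms(2-4)] adjacent_nbrs by metis
  moreover have "finite (nbrs (edges G) v)" using finite_nbrs[OF assms(1)] by blast
  ultimately show ?thesis by (metis card_0_eq empty_iff less_one not_less)
qed

lemma nbrs_leaf:
  assumes "card (nbrs (edges G) x) = 1" "adjacent G x y"
  shows "nbrs (edges G) x = {y}"
  using assms by (metis adjacent_nbrs card_1_singletonE singletonD)

text \<open>A vertex whose neighbours are all leaves is the centre of a star that cannot be left.\<close>
lemma vertices_eq_if_leaves_around:
  assumes "connected_on G (vertices G)" "y \<in> vertices G" "nbrs (edges G) y \<subseteq> vertices G"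
    and "\<And>x. x \<in> nbrs (edges G) y \<Longrightarrow> card (nbrs (edges G) x) = 1"
  shows "vertices G = insert y (nbrs (edges G) y)"
proof (rule ccontr)
  let ?C = "insert y (nbrs (edges G) y)"
  assume "vertices G \<noteq> ?C"
  moreover have "?C \<subseteq> vertices G" "?C \<noteq> {}" using assms(2,3) by auto
  ultimately obtain x c where xc: "c \<in> ?C" "x \<in> vertices G - ?C" "adjacent G x c"
    using connected_on_boundary[OF assms(1), of ?C] by metis
  show False
  proof (cases "c = y")
    case True
    then show False using xc by (metis DiffD2 adjacent_nbrs insertCI nbrs_sym)
  next
    case False
    then have c: "c \<in> nbrs (edges G) y" using xc(1) by blast
    then have "nbrs (edges G) c = {y}"
      using nbrs_leaf[OF assms(4)[OF c]] by (metis adjacent_nbrs nbrs_sym)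
    then show False using xc by (metis DiffD2 adjacent_nbrs insertCI nbrs_sym singletonD)
  qed
qed

lemma adjacent_leaves:
  assumes "simple_graph G" "connected_on G (vertices G)" "adjacent G x y"
    and "card (nbrs (edges G) x) = 1" "card (nbrs (edges G) y) = 1"
  shows "card (vertices G) = 2"
proof -
  have "nbrs (edges G) y = {x}" using nbrs_leaf[OF assms(5) adjacent_sym[OF assms(3)]] .
  then have "vertices G = {y, x}"
    using vertices_eq_if_leaves_around[OF assms(2), of y] assms(4) adjacentD[OF assms(1,3)] by simp
  then show ?thesis using adjacentD(3)[OF assms(1,3)] by simp
qed

text \<open>
  A walk can enter a leaf only to return at once to the neighbour it came from. The induction
  along the walk therefore tracks the current vertex or, at a leaf, its neighbour. At least three
  vertices are needed for that neighbour to be no leaf itself.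
\<close>
lemma connected_on_nonleaves:
  assumes G: "simple_graph G" and con: "connected_on G (vertices G)"
    and card: "3 \<le> card (vertices G)"
  shows "connected_on G {x \<in> vertices G. 2 \<le> card (nbrs (edges G) x)}" (is "connected_on G ?D")
  unfolding connected_on_def
proof (intro ballI)
  fix a b assume a: "a \<in> ?D" and b: "b \<in> ?D"
  let ?R = "\<lambda>x y. adjacent G x y \<and> x \<in> ?D \<and> y \<in> ?D"
  let ?V = "\<lambda>x y. adjacent G x y \<and> x \<in> vertices G \<and> y \<in> vertices G"
  have leaf: "card (nbrs (edges G) x) = 1" if "x \<in> vertices G" "x \<notin> ?D" for x
    using that nbrs_card_pos[OF G con _ that(1)] card by auto
  have "?V\<^sup>*\<^sup>* a b" using con a b by (auto simp: connected_on_def)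
  then have "\<forall>p\<in>?D. p = b \<or> b \<notin> ?D \<and> adjacent G b p \<longrightarrow> ?R\<^sup>*\<^sup>* a p"
  proof (induction rule: rtranclp_induct)
    case base
    then show ?case using a by blast
  next
    case (step c d)
    show ?case
    proof (intro ballI impI)
      fix p assume p: "p \<in> ?D" "p = d \<or> d \<notin> ?D \<and> adjacent G d p"
      show "?R\<^sup>*\<^sup>* a p"
      proof (cases "d \<in> ?D")
        case d: True
        then have "p = d" using p(2) by blast
        show ?thesis
        proof (cases "c \<in> ?D")
          case True
          then have "?R\<^sup>*\<^sup>* a c" using step.IH by blast
          moreover have "?R c d" using True d step.hyps(2) by blast
          ultimately show ?thesis unfolding \<open>p = d\<close> by (rule rtranclp.rtrancl_into_rtrancl)
        next
          case False
          then show ?thesis using step.IH step.hyps(2) p(1) unfolding \<open>p = d\<close> by blast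
        qed
      next
        case d: False
        have d1: "card (nbrs (edges G) d) = 1" using leaf d step.hyps(2) by blast
        have "c \<in> ?D"
        proof (rule ccontr)
          assume "c \<notin> ?D"
          then have "card (nbrs (edges G) c) = 1" using leaf step.hyps(2) by blast
          then have "card (vertices G) = 2" using adjacent_leaves[OF G con _ _ d1] step.hyps(2) by blast
          then show False using card by simp
        qed
        moreover have "p = c"
        proof -
          have "adjacent G d c" "adjacent G d p" using step.hyps(2) p d adjacent_sym[of G c d] by blast+
          then have "{c} = {p}" using nbrs_leaf[OF d1] by metis
          then show ?thesis by simp
        qed
        ultimately show ?thesis using step.IH by blast
      qed
    qed
  qed
  then show "?R\<^sup>*\<^sup>* a b" using b by blast
qed

section \<open>Cartesian products\<close>

lemma vertices_box [simp]: "vertices (G \<box> H) = vertices G \<times> vertices H"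
  by (simp add: box_product_def)

lemma mem_edges_box:
  "e \<in> edges (G \<box> H) \<longleftrightarrow>
     (\<exists>u v v'. e = {(u, v), (u, v')} \<and> u \<in> vertices G \<and> {v, v'} \<in> edges H) \<or>
     (\<exists>u u' v. e = {(u, v), (u', v)} \<and> {u, u'} \<in> edges G \<and> v \<in> vertices H)"
  by (simp add: box_product_def)

lemma simple_graph_box:
  assumes "simple_graph G" "simple_graph H"
  shows "simple_graph (G \<box> H)"
proof -
  have "finite (vertices G \<times> vertices H)" using assms by (simp add: simple_graph_def)
  moreover have "e \<subseteq> vertices G \<times> vertices H \<and> card e = 2" if "e \<in> edges (G \<box> H)" for e
  proof -
    have "(\<exists>u v v'. u \<in> vertices G \<and> adjacent H v v' \<and> e = {(u, v), (u, v')}) \<or>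
      (\<exists>u u' v. adjacent G u u' \<and> v \<in> vertices H \<and> e = {(u, v), (u', v)})"
      using that unfolding mem_edges_box adjacent_def by blast
    then show ?thesis using adjacentD[OF assms(1)] adjacentD[OF assms(2)] by auto
  qed
  ultimately show ?thesis by (simp add: simple_graph_def)
qed

lemma adjacent_box:
  "adjacent (G \<box> H) (a, b) (a', b') \<longleftrightarrow>
     a = a' \<and> a \<in> vertices G \<and> adjacent H b b' \<or> b = b' \<and> b \<in> vertices H \<and> adjacent G a a'"
  (is "?l \<longleftrightarrow> ?r")
proof
  assume ?l
  then show ?r unfolding adjacent_def mem_edges_box
    by (elim disjE exE conjE) (auto simp: doubleton_eq_iff insert_commute)
next
  assume ?r
  then show ?l unfolding adjacent_def mem_edges_box by blast
qed

lemma nbrs_box: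
  assumes "a \<in> vertices G" "b \<in> vertices H"
  shows "nbrs (edges (G \<box> H)) (a, b) = {a} \<times> nbrs (edges H) b \<union> nbrs (edges G) a \<times> {b}"
proof -
  have "(a', b') \<in> nbrs (edges (G \<box> H)) (a, b) \<longleftrightarrow>
      (a', b') \<in> {a} \<times> nbrs (edges H) b \<union> nbrs (edges G) a \<times> {b}" for a' b'
    using assms adjacent_box[of G H a b a' b'] by (auto simp: adjacent_nbrs)
  then show ?thesis by auto
qed

lemma card_nbrs_box:
  assumes "simple_graph G" "simple_graph H" "a \<in> vertices G" "b \<in> vertices H"
  shows "card (nbrs (edges (G \<box> H)) (a, b)) = card (nbrs (edges G) a) + card (nbrs (edges H) b)"
proof -
  have "finite (nbrs (edges G) a)" "finite (nbrs (edges H) b)"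
    using finite_nbrs[OF assms(1) subset_refl] finite_nbrs[OF assms(2) subset_refl] by simp_all
  moreover have "({a} \<times> nbrs (edges H) b) \<inter> (nbrs (edges G) a \<times> {b}) = {}"
    using nbrs_subset[OF assms(1)] by blast
  ultimately show ?thesis
    by (simp add: nbrs_box[OF assms(3,4)] card_Un_disjoint card_cartesian_product)
qed

lemma connected_on_box:
  assumes "connected_on G P" "connected_on H Q" "P \<subseteq> vertices G" "Q \<subseteq> vertices H"
  shows "connected_on (G \<box> H) (P \<times> Q)"
  unfolding connected_on_def
proof (intro ballI, clarify)
  let ?R = "\<lambda>x y. adjacent (G \<box> H) x y \<and> x \<in> P \<times> Q \<and> y \<in> P \<times> Q"
  fix a b a' b' assume in_PQ: "a \<in> P" "b \<in> Q" "a' \<in> P" "b' \<in> Q"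
  have "(\<lambda>x y. adjacent G x y \<and> x \<in> P \<and> y \<in> P)\<^sup>*\<^sup>* a a'"
    using assms(1) in_PQ by (auto simp: connected_on_def)
  then have "?R\<^sup>*\<^sup>* (a, b) (a', b)"
  proof (induction rule: rtranclp_induct)
    case (step c d)
    then have "?R (c, b) (d, b)" using in_PQ assms(4) by (auto simp: adjacent_box)
    with step.IH show ?case by (rule rtranclp.rtrancl_into_rtrancl)
  qed simp
  moreover have "(\<lambda>x y. adjacent H x y \<and> x \<in> Q \<and> y \<in> Q)\<^sup>*\<^sup>* b b'"
    using assms(2) in_PQ by (auto simp: connected_on_def)
  then have "?R\<^sup>*\<^sup>* (a', b) (a', b')"
  proof (induction rule: rtranclp_induct)
    case (step c d)
    then have "?R (a', c) (a', d)" using in_PQ assms(3) by (auto simp: adjacent_box)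
    with step.IH show ?case by (rule rtranclp.rtrancl_into_rtrancl)
  qed simp
  ultimately show "?R\<^sup>*\<^sup>* (a, b) (a', b')" by (rule rtranclp_trans)
qed

lemma bipartitionI:
  assumes "simple_graph G" "A \<inter> B = {}" "A \<union> B = vertices G"
    and "\<And>u v. adjacent G u v \<Longrightarrow> u \<in> A \<longleftrightarrow> v \<in> B"
  shows "bipartition G A B"
proof -
  have "\<exists>x\<in>A. \<exists>y\<in>B. e = {x, y}" if e: "e \<in> edges G" for e
  proof -
    obtain u v where uv: "e = {u, v}" using assms(1) e by (auto simp: simple_graph_def card_2_iff)
    then have "adjacent G u v" using e by (simp add: adjacent_def)
    then have "u \<in> A \<union> B" "u \<in> A \<longleftrightarrow> v \<in> B" "v \<in> A \<longleftrightarrow> u \<in> B"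
      using assms(3,4) adjacentD(1)[OF assms(1)] adjacent_sym[of G u v] by auto
    then show ?thesis using uv by (cases "u \<in> A") (auto simp: insert_commute)
  qed
  then show ?thesis using assms(2,3) by (simp add: bipartition_def)
qed

lemma bipartition_box:
  assumes "simple_graph G" "simple_graph H" "bipartition G X Y" "bipartition H X' Y'"
  shows "bipartition (G \<box> H) (X \<times> X' \<union> Y \<times> Y') (X \<times> Y' \<union> Y \<times> X')"
proof (rule bipartitionI)
  have XY: "X \<inter> Y = {}" "X \<union> Y = vertices G" "X' \<inter> Y' = {}" "X' \<union> Y' = vertices H"
    using assms(3,4) by (simp_all add: bipartition_def)
  show "simple_graph (G \<box> H)" by (rule simple_graph_box[OF assms(1,2)])
  show "(X \<times> X' \<union> Y \<times> Y') \<inter> (X \<times> Y' \<union> Y \<times> X') = {}" using XY by blast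
  show "(X \<times> X' \<union> Y \<times> Y') \<union> (X \<times> Y' \<union> Y \<times> X') = vertices (G \<box> H)"
    using XY by (simp flip: XY(2,4)) blast
  fix u v assume "adjacent (G \<box> H) u v"
  moreover obtain a b a' b' where "u = (a, b)" "v = (a', b')" by (metis surj_pair)
  ultimately have uv: "u = (a, b)" "v = (a', b')"
    "a = a' \<and> a \<in> vertices G \<and> adjacent H b b' \<or> b = b' \<and> b \<in> vertices H \<and> adjacent G a a'"
    by (simp_all add: adjacent_box)
  from uv(3) show "u \<in> X \<times> X' \<union> Y \<times> Y' \<longleftrightarrow> v \<in> X \<times> Y' \<union> Y \<times> X'"
  proof
    assume "a = a' \<and> a \<in> vertices G \<and> adjacent H b b'"
    then show ?thesis using uv(1,2) XY(1) bipartition_adjacent[OF assms(4), of b b'] by auto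
  next
    assume "b = b' \<and> b \<in> vertices H \<and> adjacent G a a'"
    then show ?thesis using uv(1,2) XY(3) bipartition_adjacent[OF assms(3), of a a'] by auto
  qed
qed

text \<open>
  Let \<open>g\<close> and \<open>h\<close> be vertices whose deletion leaves the factors connected. Beyond \<open>v = (g, h)\<close> and
  its neighbours, the product of the two smaller factors is connected, and every other vertex
  \<open>(g, b)\<close> or \<open>(a, h)\<close> is adjacent to it along a neighbour of \<open>g\<close> or of \<open>h\<close>. If \<open>v\<close> has degree
  \<open>2\<close>, then \<open>g\<close> and \<open>h\<close> are leaves, and a neighbour of \<open>v\<close> of degree \<open>2\<close> would put two adjacent leaves
  into one factor, which then would have two vertices only.
\<close>
lemma admits_VCEW_2_box_large:
  assumes G: "simple_graph G" "connected_on G (vertices G)" "3 \<le> card (vertices G)"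
    and H: "simple_graph H" "connected_on H (vertices H)" "3 \<le> card (vertices H)"
    and bip: "bipartition (G \<box> H) A B" "odd (card A)" "odd (card B)"
  shows "admits_VCEW (G \<box> H) 2"
proof -
  let ?K = "G \<box> H"
  have G2: "2 \<le> card (vertices G)" and H2: "2 \<le> card (vertices H)" using G(3) H(3) by auto
  have K: "simple_graph ?K" using simple_graph_box[OF G(1) H(1)] .
  have fin: "finite (vertices G)" "finite (vertices H)"
    using G(1) H(1) by (simp_all add: simple_graph_def)
  have ne: "vertices G \<noteq> {}" "vertices H \<noteq> {}" using G(3) H(3) by auto
  obtain g where g: "g \<in> vertices G" "connected_on G (vertices G - {g})"
    using connected_on_remove_vertex[OF fin(1) ne(1) G(2)] .
  obtain h where h: "h \<in> vertices H" "connected_on H (vertices H - {h})"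
    using connected_on_remove_vertex[OF fin(2) ne(2) H(2)] .
  let ?v = "(g, h)"
  obtain g' where g': "adjacent G g g'" using ex_nbr[OF G(2) G2 g(1)] .
  obtain h' where h': "adjacent H h h'" using ex_nbr[OF H(2) H2 h(1)] .
  have N: "nbrs (edges ?K) ?v = {g} \<times> nbrs (edges H) h \<union> nbrs (edges G) g \<times> {h}"
    using nbrs_box[OF g(1) h(1)] .
  have rest: "connected_on ?K (vertices ?K - insert ?v (nbrs (edges ?K) ?v))"
  proof (rule connected_on_extend)
    show "connected_on ?K ((vertices G - {g}) \<times> (vertices H - {h}))"
      using g h by (intro connected_on_box) auto
    show "(vertices G - {g}) \<times> (vertices H - {h}) \<subseteq> vertices ?K - insert ?v (nbrs (edges ?K) ?v)"
      by (auto simp: N)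
    fix x assume x: "x \<in> vertices ?K - insert ?v (nbrs (edges ?K) ?v)
      - (vertices G - {g}) \<times> (vertices H - {h})"
    obtain a b where ab: "x = (a, b)" by fastforce
    then have "a \<in> vertices G" "b \<in> vertices H" "a = g \<and> b \<noteq> h \<or> a \<noteq> g \<and> b = h"
      using x by auto
    then show "\<exists>w\<in>(vertices G - {g}) \<times> (vertices H - {h}). adjacent ?K x w"
      using g' h' adjacentD[OF G(1) g'] adjacentD[OF H(1) h'] ab adjacent_box[of G H] by blast
  qed
  have deg: "3 \<le> card (nbrs (edges ?K) ?v)"
    if u: "u \<in> nbrs (edges ?K) ?v" "card (nbrs (edges ?K) u) = card (nbrs (edges ?K) ?v)" for u
  proof (rule ccontr)
    assume "\<not> 3 \<le> card (nbrs (edges ?K) ?v)"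
    then have one: "card (nbrs (edges G) g) = 1" "card (nbrs (edges H) h) = 1"
      using card_nbrs_box[OF G(1) H(1) g(1) h(1)] nbrs_card_pos[OF G(1,2) G2 g(1)]
        nbrs_card_pos[OF H(1,2) H2 h(1)] by auto
    from u(1) consider b where "u = (g, b)" "adjacent H h b" | a where "u = (a, h)" "adjacent G g a"
      by (auto simp: N adjacent_nbrs)
    then show False
    proof cases
      case 1
      then have "card (nbrs (edges H) b) = 1"
        using u(2) card_nbrs_box[OF G(1) H(1) g(1)] h(1) adjacentD(2)[OF H(1)] one by simp
      then show False using adjacent_leaves[OF H(1,2) 1(2) one(2)] H(3) by simp
    next
      case 2
      then have "card (nbrs (edges G) a) = 1"
        using u(2) card_nbrs_box[OF G(1) H(1) _ h(1)] g(1) adjacentD(2)[OF G(1)] one by simp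
      then show False using adjacent_leaves[OF G(1,2) 2(2) one(1)] G(3) by simp
    qed
  qed
  have repair: "admits_VCEW ?K 2" if "bipartition ?K A' B'" "odd (card A')" "?v \<in> A'" for A' B'
    by (rule admits_VCEW_2_if_rest_connected[OF K that rest]) (rule deg)
  have "?v \<in> A \<or> ?v \<in> B" using bip(1) g(1) h(1) by (auto simp: bipartition_def)
  then show ?thesis
    using repair[OF bip(1,2)] repair[OF bipartition_swap[OF bip(1)] bip(3)] by blast
qed

text \<open>Of the two copies of a vertex of \<open>H\<close> exactly one lies in \<open>A\<close>.\<close>
lemma card_part_box_K2:
  assumes G: "simple_graph G" "vertices G = {p, q}" "adjacent G p q"
    and bip: "bipartition (G \<box> H) A B"
  shows "card A = card (vertices H)"
proof -
  have pq: "(p, h) \<in> A \<longleftrightarrow> (q, h) \<notin> A" if "h \<in> vertices H" for h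
    using bipartition_adjacent[OF bip, of "(p, h)" "(q, h)"] that G(3) by (auto simp: adjacent_box)
  have A: "A \<subseteq> {p, q} \<times> vertices H" using bip G(2) by (auto simp: bipartition_def)
  have "inj_on snd A"
  proof (rule inj_onI)
    fix x y assume "x \<in> A" "y \<in> A" "snd x = snd y"
    then show "x = y" using A pq by (cases x; cases y) auto
  qed
  moreover have "snd ` A = vertices H"
  proof
    show "snd ` A \<subseteq> vertices H" using A by auto
    show "vertices H \<subseteq> snd ` A"
    proof
      fix h assume "h \<in> vertices H"
      then have "(p, h) \<in> A \<or> (q, h) \<in> A" using pq by blast
      then show "h \<in> snd ` A" by force
    qed
  qed
  ultimately show ?thesis by (metis card_image)
qed

text \<open>
  Let \<open>D\<close> be the set of non-leaves of \<open>H\<close>, \<open>y\<close> a vertex of \<open>D\<close> that does not disconnect it, \<open>L\<close>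
  the set of leaves at \<open>y\<close>, and \<open>v = (p, y)\<close>. For a leaf \<open>x\<close> in \<open>L\<close>, the vertex \<open>(q, x)\<close> has no
  neighbours but \<open>(p, x)\<close> and \<open>(q, y)\<close>, both of which are neighbours of \<open>v\<close>; hence its parity
  must be prescribed, and the edge to \<open>(q, y)\<close> is the one that gets weight \<open>1\<close>. The set \<open>P\<close>
  gathers the \<open>H\<close>-neighbours along which \<open>(q, y)\<close> has weight \<open>1\<close>. It contains \<open>L\<close>, has even size,
  and is nonempty so that \<open>(q, y)\<close>, whose degree is that of \<open>v\<close>, gets a smaller colour than \<open>v\<close>.
\<close>
lemma admits_VCEW_2_box_K2:
  assumes G: "simple_graph G" "connected_on G (vertices G)" "card (vertices G) = 2"
    and H: "simple_graph H" "connected_on H (vertices H)" "2 \<le> card (vertices H)"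
    and bip: "bipartition (G \<box> H) A B" "odd (card A)" "odd (card B)"
  shows "admits_VCEW (G \<box> H) 2"
proof -
  let ?K = "G \<box> H"
  let ?d = "\<lambda>x. card (nbrs (edges H) x)"
  have K: "simple_graph ?K" using simple_graph_box[OF G(1) H(1)] .
  obtain p q where pq: "vertices G = {p, q}" "p \<noteq> q" using G(3) by (auto simp: card_2_iff)
  obtain q' where q': "adjacent G p q'" using ex_nbr[OF G(2), of p] G(3) pq(1) by auto
  then have "q' = q" using adjacentD(2,3)[OF G(1) q'] pq(1) by auto
  then have adj: "adjacent G p q" using q' by simp
  have nbrs_G: "nbrs (edges G) p = {q}" "nbrs (edges G) q = {p}"
    using nbrs_subset[OF G(1), of p] nbrs_subset[OF G(1), of q] adj adjacent_sym[OF adj] pq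
    by (auto simp: adjacent_nbrs)
  have odd_H: "odd (card (vertices H))"
    using card_part_box_K2[OF G(1) pq(1) adj bip(1)] bip(2) by simp
  then have H3: "3 \<le> card (vertices H)" using H(3) by presburger
  have pos: "1 \<le> ?d x" if "x \<in> vertices H" for x using nbrs_card_pos[OF H that] .
  have NH: "nbrs (edges H) x \<subseteq> vertices H - {x}" for x using nbrs_subset[OF H(1)] .
  have finH: "finite (nbrs (edges H) x)" for x using finite_nbrs[OF H(1)] by blast
  have leaf_nbr: "2 \<le> ?d z" if "?d x = 1" "adjacent H x z" for x z
  proof (rule ccontr)
    assume "\<not> 2 \<le> ?d z"
    then have "?d z = 1" using pos[of z] adjacentD(2)[OF H(1) that(2)] by simp
    then show False using adjacent_leaves[OF H(1,2) that(2,1)] H3 by simp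
  qed
  define D where "D = {x \<in> vertices H. 2 \<le> ?d x}"
  have "D \<noteq> {}"
  proof -
    obtain x where x: "x \<in> vertices H" using H3 by fastforce
    obtain z where z: "adjacent H x z" using ex_nbr[OF H(2,3) x] .
    have "2 \<le> ?d x \<or> 2 \<le> ?d z" using pos[OF x] leaf_nbr[OF _ z] by linarith
    then show ?thesis using x adjacentD(2)[OF H(1) z] by (auto simp: D_def)
  qed
  moreover have "finite D" using H(1) by (simp add: D_def simple_graph_def)
  moreover have "connected_on H D" unfolding D_def by (rule connected_on_nonleaves[OF H(1,2) H3])
  ultimately obtain y where y: "y \<in> D" "connected_on H (D - {y})"
    using connected_on_remove_vertex by blast
  have yH: "y \<in> vertices H" "2 \<le> ?d y" using y(1) by (auto simp: D_def)
  define L where "L = {x \<in> nbrs (edges H) y. ?d x = 1}"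
  define H' where "H' = vertices H - {y} - L"
  have con_H': "connected_on H H'"
  proof (rule connected_on_extend[OF y(2)])
    show "D - {y} \<subseteq> H'" by (auto simp: D_def H'_def L_def)
    fix x assume x: "x \<in> H' - (D - {y})"
    then have "x \<in> vertices H" "?d x = 1" "x \<notin> L" "x \<noteq> y"
      using pos[of x] by (auto simp: H'_def D_def)
    moreover obtain z where z: "adjacent H x z" using ex_nbr[OF H(2,3) calculation(1)] .
    moreover have "z \<noteq> y"
      using calculation z by (auto simp: L_def adjacent_nbrs nbrs_sym)
    ultimately show "\<exists>w\<in>D - {y}. adjacent H x w"
      using leaf_nbr[OF _ z] adjacentD(2)[OF H(1) z] by (auto simp: D_def)
  qed
  have "\<exists>P. L \<subseteq> P \<and> P \<subseteq> nbrs (edges H) y \<and> even (card P) \<and> P \<noteq> {}"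
  proof -
    have L: "L \<subseteq> nbrs (edges H) y" "finite L" using finH by (auto simp: L_def)
    consider "L = {}" | "L \<noteq> {}" "even (card L)" | "odd (card L)" by blast
    then show ?thesis
    proof cases
      case 1
      obtain P where "P \<subseteq> nbrs (edges H) y" "card P = 2"
        using obtain_subset_with_card_n[OF yH(2)] by metis
      then show ?thesis using 1 by (intro exI[of _ P]) auto
    next
      case 2
      then show ?thesis using L by blast
    next
      case 3
      \<comment> \<open>Otherwise \<open>H\<close> is a star with an even number of vertices, although its order is odd.\<close>
      have "L \<noteq> nbrs (edges H) y"
      proof
        assume L': "L = nbrs (edges H) y"
        have "?d x = 1" if "x \<in> nbrs (edges H) y" for x using that L' by (auto simp: L_def)
        then have "vertices H = insert y L"
          using vertices_eq_if_leaves_around[OF H(2) yH(1)] NH L' by blast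
        moreover have "y \<notin> L" using NH L' by blast
        ultimately show False using odd_H 3 L(2) by simp
      qed
      then obtain z where "z \<in> nbrs (edges H) y" "z \<notin> L" using L(1) by blast
      then show ?thesis using L 3 by (intro exI[of _ "insert z L"]) auto
    qed
  qed
  then obtain P where P: "L \<subseteq> P" "P \<subseteq> nbrs (edges H) y" "even (card P)" "P \<noteq> {}" by blast
  let ?v = "(p, y)"
  let ?N = "nbrs (edges ?K) ?v"
  let ?D = "\<lambda>x. card (nbrs (edges ?K) x)"
  have N: "?N = {p} \<times> nbrs (edges H) y \<union> {(q, y)}"
    using nbrs_box[of p G y H] pq yH(1) nbrs_G by simp
  have dK: "?D (a, x) = ?d x + 1" if "a = p \<or> a = q" "x \<in> vertices H" for a x
    using card_nbrs_box[OF G(1) H(1) _ that(2), of a] that pq nbrs_G by auto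
  have Dv: "3 \<le> ?D ?v" using dK[of p y] yH by simp
  have "\<exists>S. S \<subseteq> nbrs (edges ?K) u - {?v} \<and> card S = (if ?D u = ?D ?v then 2 else 0)"
    if "u \<in> ?N" for u
  proof -
    have "card (nbrs (edges ?K) u - {?v}) = ?D u - 1" using that by (simp add: nbrs_sym)
    then have "(if ?D u = ?D ?v then 2 else 0) \<le> card (nbrs (edges ?K) u - {?v})"
      using Dv by (cases "?D u = ?D ?v") auto
    then obtain S where "S \<subseteq> nbrs (edges ?K) u - {?v}" "card S = (if ?D u = ?D ?v then 2 else 0)"
      by (rule obtain_subset_with_card_n)
    then show ?thesis by blast
  qed
  then obtain S0 where S0: "\<And>u. u \<in> ?N \<Longrightarrow>
      S0 u \<subseteq> nbrs (edges ?K) u - {?v} \<and> card (S0 u) = (if ?D u = ?D ?v then 2 else 0)"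
    by metis
  define S where "S = S0((q, y) := {q} \<times> P)"
  have S_qy: "S (q, y) = {q} \<times> P" by (simp add: S_def)
  have S_p: "S u = S0 u" if "u \<in> ?N" "u \<noteq> (q, y)" for u using that by (simp add: S_def)
  define R where "R = vertices ?K - insert ?v ?N - {q} \<times> L"
  have R: "connected_on ?K R"
  proof (rule connected_on_extend)
    have "connected_on G {q}" by (simp add: connected_on_def)
    then show "connected_on ?K ({q} \<times> H')"
      using con_H' pq(1) by (intro connected_on_box) (auto simp: H'_def)
    show "{q} \<times> H' \<subseteq> R" using pq by (auto simp: R_def H'_def N)
    fix x assume x: "x \<in> R - {q} \<times> H'"
    obtain a b where ab: "x = (a, b)" by fastforce
    have "a = p" "b \<in> H'" using x ab pq by (auto simp: R_def H'_def N L_def)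
    then show "\<exists>w\<in>{q} \<times> H'. adjacent ?K x w"
      using ab adj by (auto simp: adjacent_box H'_def)
  qed
  have S_sub: "S u \<subseteq> nbrs (edges ?K) u - {?v}" if u: "u \<in> ?N" for u
  proof (cases "u = (q, y)")
    case True
    have "nbrs (edges ?K) (q, y) = {q} \<times> nbrs (edges H) y \<union> {(p, y)}"
      using nbrs_box[of q G y H] pq yH(1) nbrs_G by simp
    then show ?thesis using True S_qy P(2) pq(2) by auto
  qed (use S0[OF u] S_p[OF u] in simp)
  have S_even: "even (card (S u))" if u: "u \<in> ?N" for u
    using S0[OF u] S_p[OF u] S_qy P(3) by (cases "u = (q, y)") (auto simp: card_cartesian_product)
  have noconf: "2 * ?D u \<noteq> 2 * ?D ?v + card (S u)" if u: "u \<in> ?N" for u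
  proof (cases "u = (q, y)")
    case True
    have "finite P" using P(2) finH finite_subset by blast
    then have "card (S u) \<noteq> 0" using True S_qy P(4) by (simp add: card_cartesian_product)
    then show ?thesis using True dK yH(1) by simp
  next
    case False
    then show ?thesis using S0[OF u] S_p[OF u] by (cases "?D u = ?D ?v") auto
  qed
  \<comment> \<open>Stated for an arbitrary part \<open>A'\<close> as \<open>v\<close> may lie in \<open>A\<close> or in \<open>B\<close>.\<close>
  have rest: "z \<in> A' \<and> odd (card {u \<in> ?N. z \<in> S u})"
    if z: "z \<in> vertices ?K - insert ?v ?N - R" and A': "bipartition ?K A' B'" "?v \<in> A'" for z A' B'
  proof -
    obtain x where x: "z = (q, x)" "x \<in> L" using z by (auto simp: R_def)
    then have xy: "x \<in> nbrs (edges H) y" "?d x = 1" by (auto simp: L_def)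
    have "adjacent ?K (p, y) (q, y)" using adj yH(1) by (simp add: adjacent_box)
    moreover have "adjacent ?K (q, y) (q, x)" using xy(1) pq(1) by (simp add: adjacent_box adjacent_nbrs[of H])
    ultimately have "z \<in> A'"
      using bipartition_adjacent[OF A'(1)] A'(2) x(1) by blast
    moreover have "{u \<in> ?N. z \<in> S u} = {(q, y)}"
    proof (intro equalityI subsetI)
      fix u assume "u \<in> {u \<in> ?N. z \<in> S u}"
      then have u: "u \<in> ?N" "z \<in> S u" by auto
      show "u \<in> {(q, y)}"
      proof (rule ccontr)
        assume "u \<notin> {(q, y)}"
        then have u': "u \<noteq> (q, y)" by simp
        then obtain w where w: "u = (p, w)" "w \<in> nbrs (edges H) y" using u(1) N by auto
        have "z \<in> nbrs (edges ?K) u" using S_sub[OF u(1)] u(2) by blast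
        then have "adjacent ?K (p, w) (q, x)" using w(1) x(1) by (simp add: adjacent_nbrs)
        then have "w = x" using pq(2) by (simp add: adjacent_box)
        moreover have "x \<in> vertices H" using xy(1) NH by blast
        ultimately have "?D u \<noteq> ?D ?v" using dK[of p x] w(1) xy(2) Dv by simp
        moreover have "finite (S0 u)"
          using S0[OF u(1)] finite_nbrs[OF K, of "edges ?K" u] finite_subset by blast
        ultimately have "S u = {}" using S0[OF u(1)] S_p[OF u(1) u'] by simp
        then show False using u(2) by simp
      qed
    qed (use x P(1) N S_qy in auto)
    ultimately show ?thesis by simp
  qed
  have "?v \<in> A \<or> ?v \<in> B" using bip(1) pq(1) yH(1) by (auto simp: bipartition_def)
  then show ?thesis
  proof
    assume v: "?v \<in> A"
    show ?thesis
      by (rule admits_VCEW_2_if_repairable[OF K bip(1,2) v _ R S_sub S_even noconf rest[OF _ bip(1) v]])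
         (auto simp: R_def)
  next
    assume v: "?v \<in> B"
    note bip' = bipartition_swap[OF bip(1)]
    show ?thesis
      by (rule admits_VCEW_2_if_repairable[OF K bip' bip(3) v _ R S_sub S_even noconf rest[OF _ bip' v]])
         (auto simp: R_def)
  qed
qed

section \<open>Relabelling\<close>

text \<open>
  Invariance under injective renaming serves twice: to exchange the factors of a product, and to
  treat the cube, which is a renamed product at each step of its recursion.
\<close>

lemma relabel_simps [simp]:
  "vertices (relabel f G) = f ` vertices G" "edges (relabel f G) = (`) f ` edges G"
  by (simp_all add: relabel_def)

lemma adjacent_relabel:
  assumes "inj f"
  shows "adjacent (relabel f G) x y \<longleftrightarrow> (\<exists>u v. x = f u \<and> y = f v \<and> adjacent G u v)"
proof
  assume "adjacent (relabel f G) x y"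
  then obtain e where e: "e \<in> edges G" "{x, y} = f ` e" by (auto simp: adjacent_def)
  then obtain u v where uv: "x = f u" "y = f v" by blast
  then have "f ` {u, v} = f ` e" using e(2) by simp
  then have "{u, v} = e" by (rule iffD1[OF inj_image_eq_iff[OF assms]])
  then show "\<exists>u v. x = f u \<and> y = f v \<and> adjacent G u v" using e(1) uv by (auto simp: adjacent_def)
next
  assume "\<exists>u v. x = f u \<and> y = f v \<and> adjacent G u v"
  then obtain u v where "x = f u" "y = f v" "{u, v} \<in> edges G" by (auto simp: adjacent_def)
  then show "adjacent (relabel f G) x y" unfolding adjacent_def relabel_simps
    by (intro image_eqI[of _ _ "{u, v}"]) auto
qed

lemma simple_graph_relabel:
  assumes "inj f" "simple_graph G"
  shows "simple_graph (relabel f G)"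
  using assms by (auto simp: simple_graph_def card_image inj_on_subset[OF assms(1)])

lemma connected_on_relabel:
  assumes "inj f" "connected_on G W"
  shows "connected_on (relabel f G) (f ` W)"
  unfolding connected_on_def
proof (intro ballI, clarify)
  let ?R = "\<lambda>x y. adjacent (relabel f G) x y \<and> x \<in> f ` W \<and> y \<in> f ` W"
  fix a b assume "a \<in> W" "b \<in> W"
  then have "(\<lambda>x y. adjacent G x y \<and> x \<in> W \<and> y \<in> W)\<^sup>*\<^sup>* a b"
    using assms(2) by (auto simp: connected_on_def)
  then show "?R\<^sup>*\<^sup>* (f a) (f b)"
  proof (induction rule: rtranclp_induct)
    case (step c d)
    then have "?R (f c) (f d)" using adjacent_relabel[OF assms(1)] by auto
    with step.IH show ?case by (rule rtranclp.rtrancl_into_rtrancl)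
  qed simp
qed

lemma bipartition_relabel:
  assumes "inj f" "simple_graph G" "bipartition G A B"
  shows "bipartition (relabel f G) (f ` A) (f ` B)"
proof (rule bipartitionI)
  have AB: "A \<inter> B = {}" "A \<union> B = vertices G" using assms(3) by (simp_all add: bipartition_def)
  show "simple_graph (relabel f G)" by (rule simple_graph_relabel[OF assms(1,2)])
  show "f ` A \<inter> f ` B = {}" using AB(1) assms(1) by (simp flip: image_Int)
  show "f ` A \<union> f ` B = vertices (relabel f G)" by (simp flip: AB(2) image_Un)
  fix x y assume "adjacent (relabel f G) x y"
  then show "x \<in> f ` A \<longleftrightarrow> y \<in> f ` B"
    using bipartition_adjacent[OF assms(3)] adjacent_relabel[OF assms(1)]
    by (metis assms(1) inj_image_mem_iff)
qed

lemma VCEW_relabel: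
  assumes "inj f"
  shows "VCEW (relabel f G) k w \<longleftrightarrow> VCEW G k (\<lambda>e. w (f ` e))"
proof -
  have "induced_coloring (relabel f G) w (f v) = induced_coloring G (\<lambda>e. w (f ` e)) v" for v
  proof -
    have "{e. e \<in> edges (relabel f G) \<and> f v \<in> e} = (`) f ` {e. e \<in> edges G \<and> v \<in> e}"
      using inj_eq[OF assms] by auto
    moreover have "inj_on ((`) f) X" for X using assms by (auto simp: inj_on_def inj_image_eq_iff)
    ultimately show ?thesis unfolding induced_coloring_def by (simp add: sum.reindex)
  qed
  then show ?thesis
    unfolding VCEW_def edge_weighting_def proper_coloring_def adjacent_relabel[OF assms]
    by fastforce
qed

lemma admits_VCEW_relabel:
  assumes "inj f"
  shows "admits_VCEW (relabel f G) k \<longleftrightarrow> admits_VCEW G k"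
proof
  assume "admits_VCEW G k"
  then obtain w where "VCEW G k w" by (auto simp: admits_VCEW_def)
  then have "VCEW (relabel f G) k (\<lambda>e. w (f -` e))"
    using assms by (simp add: VCEW_relabel inj_vimage_image_eq)
  then show "admits_VCEW (relabel f G) k" by (auto simp: admits_VCEW_def)
qed (auto simp: admits_VCEW_def VCEW_relabel[OF assms])

lemma mu_relabel: "inj f \<Longrightarrow> mu (relabel f G) = mu G"
  by (simp add: mu_def admits_VCEW_relabel)

lemma relabel_swap_box: "relabel prod.swap (G \<box> H) = H \<box> G"
proof -
  have "(`) prod.swap ` {{(u, v), (u, v')} | u v v'. u \<in> vertices G \<and> {v, v'} \<in> edges H}
      = {{(v, u), (v', u)} | v v' u. {v, v'} \<in> edges H \<and> u \<in> vertices G}"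
    unfolding image_Collect by (auto 0 4)
  moreover have "(`) prod.swap ` {{(u, v), (u', v)} | u u' v. {u, u'} \<in> edges G \<and> v \<in> vertices H}
      = {{(v, u), (v, u')} | v u u'. v \<in> vertices H \<and> {u, u'} \<in> edges G}"
    unfolding image_Collect by (auto 0 4)
  ultimately show ?thesis
    unfolding relabel_def box_product_def by (simp add: image_Un Un_commute product_swap)
qed

section \<open>Products of bipartite graphs\<close>

lemma admits_VCEW_2_box:
  assumes G: "simple_graph G" "connected_on G (vertices G)" "bipartite_graph G" "2 \<le> card (vertices G)"
    and H: "simple_graph H" "connected_on H (vertices H)" "bipartite_graph H" "2 \<le> card (vertices H)"
  shows "admits_VCEW (G \<box> H) 2"
proof -
  have K: "simple_graph (G \<box> H)" by (rule simple_graph_box[OF G(1) H(1)])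
  have con: "connected_on (G \<box> H) (vertices (G \<box> H))"
    using connected_on_box[OF G(2) H(2)] by simp
  obtain A B where bip: "bipartition (G \<box> H) A B"
    using G(3) H(3) bipartition_box[OF G(1) H(1)] unfolding bipartite_graph_iff by blast
  consider "even (card A)" | "even (card B)" | "odd (card A)" "odd (card B)" by blast
  then show ?thesis
  proof cases
    case 1
    then show ?thesis by (rule admits_VCEW_2_if_even_part[OF K con bip])
  next
    case 2
    then show ?thesis by (rule admits_VCEW_2_if_even_part[OF K con bipartition_swap[OF bip]])
  next
    case 3
    consider "card (vertices G) = 2" | "card (vertices H) = 2"
      | "3 \<le> card (vertices G)" "3 \<le> card (vertices H)" using G(4) H(4) by linarith
    then show ?thesis
    proof cases
      case 1
      then show ?thesis using admits_VCEW_2_box_K2[OF G(1,2) _ H(1,2,4) bip 3] by blast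
    next
      case 2
      have "bipartition (H \<box> G) (prod.swap ` A) (prod.swap ` B)"
        using bipartition_relabel[OF inj_swap K bip] by (simp add: relabel_swap_box)
      moreover have "card (prod.swap ` X) = card X" for X :: "('a \<times> 'b) set"
        by (simp add: card_image)
      ultimately have "admits_VCEW (H \<box> G) 2"
        using admits_VCEW_2_box_K2[OF H(1,2) 2 G(1,2,4)] 3 by metis
      then show ?thesis using admits_VCEW_relabel[OF inj_swap, of "G \<box> H"] by (simp add: relabel_swap_box)
    next
      case 3
      then show ?thesis
        using admits_VCEW_2_box_large[OF G(1,2) _ H(1,2) _ bip] \<open>odd (card A)\<close> \<open>odd (card B)\<close> by blast
    qed
  qed
qed

text \<open>
  An edge of \<open>G\<close> with ends of equal degree keeps this property in every copy of \<open>G\<close> inside the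
  product, as both degrees grow by the degree of the same vertex of \<open>H\<close>.
\<close>
lemma not_admits_VCEW_1_box:
  assumes "simple_graph G" "simple_graph H" "vertices H \<noteq> {}" "\<not> admits_VCEW G 1"
  shows "\<not> admits_VCEW (G \<box> H) 1"
proof -
  obtain u v where uv: "adjacent G u v" "card (nbrs (edges G) u) = card (nbrs (edges G) v)"
    using assms(4) not_admits_VCEW_1_iff[OF assms(1)] by blast
  obtain h where h: "h \<in> vertices H" using assms(3) by blast
  have "adjacent (G \<box> H) (u, h) (v, h)" using uv(1) h by (simp add: adjacent_box)
  moreover have "card (nbrs (edges (G \<box> H)) (u, h)) = card (nbrs (edges (G \<box> H)) (v, h))"
    using card_nbrs_box[OF assms(1,2) _ h] adjacentD[OF assms(1) uv(1)] uv(2) by simp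
  ultimately show ?thesis using not_admits_VCEW_1_iff[OF simple_graph_box[OF assms(1,2)]] by blast
qed

lemma mu_box_eq_2:
  assumes G: "simple_graph G" "connected_on G (vertices G)" "bipartite_graph G" "2 \<le> card (vertices G)"
    and H: "simple_graph H" "connected_on H (vertices H)" "bipartite_graph H" "2 \<le> card (vertices H)"
    and "\<not> admits_VCEW G 1 \<or> \<not> admits_VCEW H 1"
  shows "mu (G \<box> H) = 2"
proof (rule mu_eq_2I)
  have ne: "vertices G \<noteq> {}" "vertices H \<noteq> {}" using G(4) H(4) by auto
  obtain g where g: "g \<in> vertices G" using ne(1) by blast
  obtain u where "adjacent G g u" using ex_nbr[OF G(2,4) g] .
  moreover obtain h where "h \<in> vertices H" using ne(2) by blast
  ultimately have "adjacent (G \<box> H) (g, h) (u, h)" by (simp add: adjacent_box)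
  then show "edges (G \<box> H) \<noteq> {}" by (auto simp: adjacent_def)
  show "admits_VCEW (G \<box> H) 2" by (rule admits_VCEW_2_box[OF G H])
  from assms(9) show "\<not> admits_VCEW (G \<box> H) 1"
  proof
    assume "\<not> admits_VCEW G 1"
    then show ?thesis by (rule not_admits_VCEW_1_box[OF G(1) H(1) ne(2)])
  next
    assume "\<not> admits_VCEW H 1"
    then have "\<not> admits_VCEW (H \<box> G) 1" by (rule not_admits_VCEW_1_box[OF H(1) G(1) ne(1)])
    then show ?thesis
      using admits_VCEW_relabel[OF inj_swap, of "G \<box> H"] by (simp add: relabel_swap_box)
  qed
qed

section \<open>Paths, cycles and cubes\<close>

lemma simple_graph_path: "simple_graph (path_graph n)"
  by (auto simp: simple_graph_def path_graph_def)

lemma adjacent_path: "adjacent (path_graph n) i j \<longleftrightarrow> i < n \<and> j < n \<and> (j = Suc i \<or> i = Suc j)"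
  by (auto simp: adjacent_def path_graph_def doubleton_eq_iff)

lemma simple_graph_cycle: "2 \<le> n \<Longrightarrow> simple_graph (cycle_graph n)"
proof -
  assume n: "2 \<le> n"
  have "i \<noteq> (i + 1) mod n" if "i < n" for i
    using that n by (cases "i + 1 = n") auto
  then show ?thesis using n by (auto simp: simple_graph_def cycle_graph_def)
qed

lemma adjacent_cycle:
  assumes "3 \<le> n"
  shows "adjacent (cycle_graph n) i j \<longleftrightarrow> i < n \<and> j < n \<and>
    (j = Suc i \<or> i = Suc j \<or> i = 0 \<and> j = n - 1 \<or> j = 0 \<and> i = n - 1)"
proof -
  have mod: "(k + 1) mod n = (if k = n - 1 then 0 else k + 1)" if "k < n" for k
    using that by auto
  have "adjacent (cycle_graph n) i j \<longleftrightarrow> i < n \<and> j = (i + 1) mod n \<or> j < n \<and> i = (j + 1) mod n"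
    unfolding adjacent_def cycle_graph_def by (auto simp: doubleton_eq_iff)
  also have "\<dots> \<longleftrightarrow> i < n \<and> j = (if i = n - 1 then 0 else i + 1)
      \<or> j < n \<and> i = (if j = n - 1 then 0 else j + 1)"
    using mod by metis
  finally show ?thesis using assms by (auto split: if_splits)
qed

lemma connected_on_initial_segment:
  assumes "\<And>i. Suc i < n \<Longrightarrow> adjacent G i (Suc i)"
  shows "connected_on G {..<n}"
proof (rule connected_onI_root)
  fix i assume "i \<in> {..<n}"
  then show "(\<lambda>x y. adjacent G x y \<and> x \<in> {..<n} \<and> y \<in> {..<n})\<^sup>*\<^sup>* 0 i"
  proof (induction i)
    case (Suc i)
    then have "adjacent G i (Suc i) \<and> i \<in> {..<n} \<and> Suc i \<in> {..<n}" using assms by simp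
    with Suc show ?case by (metis (no_types, lifting) rtranclp.rtrancl_into_rtrancl)
  qed simp
qed

lemma bipartite_if_adjacent_parity:
  assumes "simple_graph G" "\<And>i j. adjacent G i j \<Longrightarrow> even i \<noteq> even j"
  shows "bipartite_graph (G :: nat sgraph)"
proof -
  have "bipartition G {i \<in> vertices G. even i} {i \<in> vertices G. odd i}"
    using assms adjacentD[OF assms(1)] by (intro bipartitionI) blast+
  then show ?thesis by (auto simp: bipartite_graph_iff)
qed

lemma path_graph_props:
  shows "connected_on (path_graph n) (vertices (path_graph n))"
    and "bipartite_graph (path_graph n)" and "card (vertices (path_graph n)) = n"
proof -
  have V: "vertices (path_graph n) = {..<n}" by (simp add: path_graph_def)
  show "connected_on (path_graph n) (vertices (path_graph n))"
    unfolding V by (rule connected_on_initial_segment) (simp add: adjacent_path)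
  show "bipartite_graph (path_graph n)"
    by (rule bipartite_if_adjacent_parity[OF simple_graph_path]) (auto simp: adjacent_path)
  show "card (vertices (path_graph n)) = n" by (simp add: V)
qed

lemma cycle_graph_props:
  assumes "3 \<le> n"
  shows "connected_on (cycle_graph n) (vertices (cycle_graph n))"
    and "even n \<Longrightarrow> bipartite_graph (cycle_graph n)" and "card (vertices (cycle_graph n)) = n"
proof -
  have V: "vertices (cycle_graph n) = {..<n}" by (simp add: cycle_graph_def)
  show "connected_on (cycle_graph n) (vertices (cycle_graph n))"
    unfolding V by (rule connected_on_initial_segment) (simp add: adjacent_cycle[OF assms])
  show "bipartite_graph (cycle_graph n)" if "even n"
    using assms that
    by (intro bipartite_if_adjacent_parity simple_graph_cycle) (auto simp: adjacent_cycle)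
  show "card (vertices (cycle_graph n)) = n" by (simp add: V)
qed

text \<open>
  In a path with at least four vertices, and likewise in a cycle, the adjacent vertices \<open>1\<close> and \<open>2\<close>
  both have degree \<open>2\<close>.
\<close>
lemma not_admits_VCEW_1_path:
  assumes "4 \<le> n"
  shows "\<not> admits_VCEW (path_graph n) 1"
proof -
  have "nbrs (edges (path_graph n)) 1 = {0, 2}" "nbrs (edges (path_graph n)) 2 = {1, 3}"
    using assms by (auto simp: adjacent_path simp flip: adjacent_nbrs)
  moreover have "adjacent (path_graph n) 1 2" using assms by (simp add: adjacent_path)
  ultimately show ?thesis unfolding not_admits_VCEW_1_iff[OF simple_graph_path]
    by (intro exI[of _ 1] exI[of _ 2]) simp
qed

lemma not_admits_VCEW_1_cycle:
  assumes "4 \<le> n"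
  shows "\<not> admits_VCEW (cycle_graph n) 1"
proof -
  have n: "3 \<le> n" "2 \<le> n" using assms by auto
  have "nbrs (edges (cycle_graph n)) 1 = {0, 2}" "nbrs (edges (cycle_graph n)) 2 = {1, 3}"
    using assms by (auto simp: adjacent_cycle[OF n(1)] simp flip: adjacent_nbrs)
  moreover have "adjacent (cycle_graph n) 1 2" using assms by (simp add: adjacent_cycle[OF n(1)])
  ultimately show ?thesis unfolding not_admits_VCEW_1_iff[OF simple_graph_cycle[OF n(2)]]
    by (intro exI[of _ 1] exI[of _ 2]) simp
qed

lemma complete_graph_2: "complete_graph 2 = path_graph 2"
proof -
  have "{{i, j} | i j. i < 2 \<and> j < 2 \<and> i \<noteq> j} = {{i, i + 1} | i. i + 1 < (2 :: nat)}"
    by (auto simp: less_2_cases_iff doubleton_eq_iff)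
  then show ?thesis by (simp add: complete_graph_def path_graph_def)
qed

lemma not_admits_VCEW_1_path_2: "\<not> admits_VCEW (path_graph 2) 1"
proof -
  have "nbrs (edges (path_graph 2)) 0 = {1}" "nbrs (edges (path_graph 2)) 1 = {0}"
    by (auto simp: adjacent_path simp flip: adjacent_nbrs)
  moreover have "adjacent (path_graph 2) 0 1" by (simp add: adjacent_path)
  ultimately show ?thesis unfolding not_admits_VCEW_1_iff[OF simple_graph_path]
    by (intro exI[of _ 0] exI[of _ 1]) simp
qed

lemma cube_graph_props:
  "simple_graph (cube_graph n) \<and> connected_on (cube_graph n) (vertices (cube_graph n)) \<and>
   bipartite_graph (cube_graph n) \<and> card (vertices (cube_graph n)) = 2 ^ n"
proof (induction n)
  case 0
  have "bipartition (cube_graph 0) {[]} {}" by (simp add: bipartition_def)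
  then show ?case by (auto simp: simple_graph_def connected_on_def bipartite_graph_iff)
next
  case (Suc n)
  let ?f = "\<lambda>(x, xs). x # xs :: nat list" and ?K = "path_graph 2 \<box> cube_graph n"
  have f: "inj ?f" by (auto simp: inj_def)
  have cube: "cube_graph (Suc n) = relabel ?f ?K" by (simp add: complete_graph_2)
  have K: "simple_graph ?K" using Suc simple_graph_box simple_graph_path by blast
  have "connected_on ?K (vertices ?K)" using connected_on_box path_graph_props(1) Suc by fastforce
  then have "connected_on (cube_graph (Suc n)) (vertices (cube_graph (Suc n)))"
    unfolding cube relabel_simps by (rule connected_on_relabel[OF f])
  moreover obtain A B where "bipartition ?K A B"
    using Suc path_graph_props(2)[of 2] bipartition_box[OF simple_graph_path]
    unfolding bipartite_graph_iff by metis
  then have "bipartite_graph (cube_graph (Suc n))"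
    unfolding cube bipartite_graph_iff using bipartition_relabel[OF f K] by blast
  moreover have "card (vertices (cube_graph (Suc n))) = 2 ^ Suc n"
    unfolding cube relabel_simps using Suc path_graph_props(3)[of 2]
    by (simp add: card_image inj_on_subset[OF f] card_cartesian_product)
  ultimately show ?case using simple_graph_relabel[OF f K] unfolding cube by blast
qed

text \<open>The cube is split as \<open>K\<^sub>2\<close> times a cube of positive dimension, which has at least two vertices.\<close>
lemma mu_cube_eq_2:
  assumes "2 \<le> n"
  shows "mu (cube_graph n) = 2"
proof -
  obtain m where m: "n = Suc m" "1 \<le> m" using assms by (cases n) auto
  have "(2 :: nat) ^ 1 \<le> 2 ^ m" using m(2) by (intro power_increasing) auto
  then have "2 \<le> card (vertices (cube_graph m))" using cube_graph_props[of m] by simp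
  then have "mu (path_graph 2 \<box> cube_graph m) = 2"
    using cube_graph_props[of m] path_graph_props[of 2] not_admits_VCEW_1_path_2
    by (intro mu_box_eq_2 simple_graph_path) auto
  moreover have "inj (\<lambda>(x, xs). x # xs :: nat list)" by (auto simp: inj_def)
  ultimately show ?thesis by (simp add: m(1) complete_graph_2 mu_relabel)
qed

theorem corollary2p6:
  shows "(\<forall>(G :: 'a sgraph) (H :: 'b sgraph).
            simple_graph G \<and> connected_graph G \<and> bipartite_graph G \<and> card (vertices G) \<ge> 2 \<and>
            simple_graph H \<and> connected_graph H \<and> bipartite_graph H \<and> card (vertices H) \<ge> 2 \<and>
            (\<not> admits_VCEW G 1 \<or> \<not> admits_VCEW H 1)
            \<longrightarrow> mu (G \<box> H) = 2)
       \<and> (\<forall>n m. n \<ge> 3 \<and> m \<ge> 3 \<and> even n \<and> even m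
            \<longrightarrow> mu (cycle_graph n \<box> cycle_graph m) = 2)
       \<and> (\<forall>n m. n \<ge> 3 \<and> m \<ge> 3 \<and> even n
            \<longrightarrow> mu (cycle_graph n \<box> path_graph m) = 2)
       \<and> (\<forall>n m. n \<ge> 3 \<and> m \<ge> 3 \<and> \<not> (n = 3 \<and> m = 3)
            \<longrightarrow> mu (path_graph n \<box> path_graph m) = 2)
       \<and> (\<forall>n. n \<ge> 2 \<longrightarrow> mu (cube_graph n) = 2)"
proof (intro conjI allI impI; (elim conjE)?)
  fix G :: "'a sgraph" and H :: "'b sgraph"
  assume "simple_graph G" "connected_graph G" "bipartite_graph G" "card (vertices G) \<ge> 2"
    "simple_graph H" "connected_graph H" "bipartite_graph H" "card (vertices H) \<ge> 2"
    "\<not> admits_VCEW G 1 \<or> \<not> admits_VCEW H 1"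
  then show "mu (G \<box> H) = 2"
    by (intro mu_box_eq_2) (simp_all add: connected_on_vertices_iff connected_graph_def)
next
  fix n m :: nat assume nm: "n \<ge> 3" "m \<ge> 3" "even n" "even m"
  then have "4 \<le> n" by presburger
  then show "mu (cycle_graph n \<box> cycle_graph m) = 2"
    using nm by (intro mu_box_eq_2)
      (simp_all add: cycle_graph_props simple_graph_cycle not_admits_VCEW_1_cycle[unfolded One_nat_def])
next
  fix n m :: nat assume nm: "n \<ge> 3" "m \<ge> 3" "even n"
  then have "4 \<le> n" by presburger
  then show "mu (cycle_graph n \<box> path_graph m) = 2"
    using nm by (intro mu_box_eq_2)
      (simp_all add: cycle_graph_props simple_graph_cycle path_graph_props simple_graph_path
        not_admits_VCEW_1_cycle[unfolded One_nat_def])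
next
  fix n m :: nat assume nm: "n \<ge> 3" "m \<ge> 3" "\<not> (n = 3 \<and> m = 3)"
  then have "4 \<le> n \<or> 4 \<le> m" by auto
  then have "\<not> admits_VCEW (path_graph n) 1 \<or> \<not> admits_VCEW (path_graph m) 1"
    using not_admits_VCEW_1_path by blast
  then show "mu (path_graph n \<box> path_graph m) = 2"
    using nm by (intro mu_box_eq_2) (simp_all add: path_graph_props simple_graph_path)
qed (rule mu_cube_eq_2)

end
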